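(* Let $\mathbb{X}$ and $\mathbb{Y}$ be quasi-Banach spaces whose quasi-norms have constants $C_{\mathbb{X}}$, $C_{\mathbb{Y}}$, let $T\in\mathcal{L}(\mathbb{X},\mathbb{Y})$, and let $0<p<\infty$. Then: (i) there is a constant $c_p>0$ (which may depend on $p$ and on the quasi-norm constants of the spaces, but not on $T$ or $n$) such that $$e_{n}(T)\leq c_{p}\left(\frac{1}{n}\sum_{i=1}^{n}\left(a_{i}(T)\right)^{p}\right)^{1/p}\quad\text{for } n=1,2,\ldots;$$ (ii) $\displaystyle\lim_{n\rightarrow\infty}e_{n}(T)\leq\lim_{n\rightarrow\infty}a_{n}(T)$.
   Context: Vector spaces are over $\mathbb{K}=\mathbb{R}$ or $\mathbb{C}$. A quasi-norm with constant $C\geq1$ on a vector space $\mathbb{X}$ is a map $\Vert\cdot\Vert:\mathbb{X}\to[0,\infty)$ with $\Vert x\Vert=0\iff x=0$, $\Vert\lambda x\Vert=|\lambda|\Vert x\Vert$, and $\Vert x+y\Vert\leq C(\Vert x\Vert+\Vert y\Vert)$. A quasi-Banach space is a complete quasi-normed space. $\overline{B}_{\mathbb{X}}=\{x\in\mathbb{X}:\Vert x\Vert_{\mathbb{X}}\leq1\}$. $\mathcal{L}(\mathbb{X},\mathbb{Y})$ is the space of bounded linear operators, with $\Vert T\Vert=\sup_{\Vert x\Vert_{\mathbb{X}}\leq1}\Vert Tx\Vert_{\mathbb{Y}}$; $\operatorname{rank}S$ is the dimension of the range of $S$. For $n\in\mathbb{N}=\{1,2,\ldots\}$ the $n$-th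 (dyadic) entropy number of $T\in\mathcal{L}(\mathbb{X},\mathbb{Y})$ is $$e_{n}(T):=\inf\Big\{\varepsilon>0:\ \exists\,y_{1},\ldots,y_{2^{n-1}}\in\mathbb{Y}:\ T(\overline{B}_{\mathbb{X}})\subseteq\bigcup_{i=1}^{2^{n-1}}\{y_{i}+\varepsilon\overline{B}_{\mathbb{Y}}\}\Big\},$$ and the $n$-th approximation number is $$a_{n}(T):=\inf\{\Vert T-S\Vert:\ S\in\mathcal{L}(\mathbb{X},\mathbb{Y}),\ \operatorname{rank}S<n\}.$$ Both sequences are nonincreasing, so the limits exist.
   Formalization: Part (ii) fails for discontinuous quasi-norms; it is proved when the quasi-norm of Y is an r-norm (0<r≤1), and in general as lim e_n ≤ C_Y lim a_n. In (i) the constant is uniform over all subspaces of fixed ambient spaces; a direct sum gives full uniformity. *)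

theory Defs
  imports "HOL-Analysis.Analysis" "HOL-Library.Extended_Nat"
begin

text \<open>
  The scalar fields \<open>\<real>\<close> and \<open>\<complex>\<close>, up to isometric isomorphism: either every scalar is
  real, or there is an imaginary unit \<open>i\<close>, every scalar is \<open>a + b i\<close> with real \<open>a\<close>, \<open>b\<close>, and
  the absolute value is the complex modulus.
\<close>

class real_or_complex = real_normed_field +
  assumes real_or_complex:
    "(\<forall>z. \<exists>a. z = a *\<^sub>R 1) \<or>
     (\<exists>i. i * i = - 1 \<and>
        (\<forall>z. \<exists>a b. z = a *\<^sub>R 1 + b *\<^sub>R i \<and> norm z = cmod (Complex a b)))"

instance real :: real_or_complex
  by standard simp

instance complex :: real_or_complex
proof
  have "\<exists>a b. z = a *\<^sub>R 1 + b *\<^sub>R \<i> \<and> norm z = cmod (Complex a b)" for z :: complex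
    by (intro exI[of _ "Re z"] exI[of _ "Im z"]) (simp add: complex_eq_iff)
  then show "(\<forall>z::complex. \<exists>a. z = a *\<^sub>R 1) \<or>
     (\<exists>i::complex. i * i = - 1 \<and>
        (\<forall>z. \<exists>a b. z = a *\<^sub>R 1 + b *\<^sub>R i \<and> norm z = cmod (Complex a b)))"
    using i_squared by blast
qed

text \<open>
  A space is a linear subspace \<open>points\<close> of an ambient vector space \<open>('v, smul)\<close> together with a
  function \<open>qnorm\<close>, which matters only on \<open>points\<close>. A whole type is the case \<open>points = UNIV\<close>.
  Since the space is a value rather than a type, a constant can be chosen before
  quantifying over spaces.
\<close>

record ('k, 'v) space_data =
  smul :: "'k \<Rightarrow> 'v \<Rightarrow> 'v"
  points :: "'v set"
  qnorm :: "'v \<Rightarrow> real"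

locale quasi_normed_space = vector_space "smul X"
  for X :: "('k::real_or_complex, 'v::ab_group_add) space_data" +
  fixes C :: real
  assumes points_subspace: "subspace (points X)"
    and const_ge_1: "C \<ge> 1"
    and qnorm_nonneg: "x \<in> points X \<Longrightarrow> qnorm X x \<ge> 0"
    and qnorm_eq_0_iff: "x \<in> points X \<Longrightarrow> qnorm X x = 0 \<longleftrightarrow> x = 0"
    and qnorm_smul: "x \<in> points X \<Longrightarrow> qnorm X (smul X c x) = norm c * qnorm X x"
    and qnorm_add: "x \<in> points X \<Longrightarrow> y \<in> points X \<Longrightarrow>
        qnorm X (x + y) \<le> C * (qnorm X x + qnorm X y)"

locale quasi_banach_space = quasi_normed_space +
  assumes complete: "\<lbrakk>\<forall>k::nat. u k \<in> points X;
      \<forall>\<epsilon>>0. \<exists>N. \<forall>m\<ge>N. \<forall>k\<ge>N. qnorm X (u m - u k) < \<epsilon>\<rbrakk>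
      \<Longrightarrow> \<exists>l\<in>points X. (\<lambda>k. qnorm X (u k - l)) \<longlonglongrightarrow> 0"

text \<open>
  A quasi-norm satisfying only \<open>\<parallel>x + y\<parallel> \<le> C (\<parallel>x\<parallel> + \<parallel>y\<parallel>)\<close> may be discontinuous, and then the limit of
  the entropy numbers can exceed the limit of the approximation numbers. Example: let \<open>Z\<close> be
  an infinite-dimensional Banach space, \<open>X = \<real> \<times> Z\<close> with the maximum norm, and let \<open>Y = \<real> \<times> Z\<close>
  carry the quasi-norm (with \<open>C = 2\<close>) that is \<open>\<parallel>z\<parallel>\<close> at \<open>(0, z)\<close> and twice the maximum norm at
  \<open>(t, z)\<close> with \<open>t \<noteq> 0\<close>. The identity from \<open>X\<close> to \<open>Y\<close> has \<open>a\<^sub>n \<le> 1\<close> for \<open>n \<ge> 2\<close> but \<open>e\<^sub>n = 2\<close> for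
  all \<open>n\<close>. The sharp comparison of limits is therefore stated for \<open>r\<close>-norms; by the
  Aoki--Rolewicz theorem every quasi-norm is equivalent to one.
\<close>

definition r_norm :: "('k, 'v::ab_group_add) space_data \<Rightarrow> real \<Rightarrow> bool" where
  "r_norm X r \<longleftrightarrow> 0 < r \<and> r \<le> 1 \<and>
     (\<forall>x\<in>points X. \<forall>y\<in>points X.
        qnorm X (x + y) powr r \<le> qnorm X x powr r + qnorm X y powr r)"

definition closed_unit_ball :: "('k, 'v) space_data \<Rightarrow> 'v set" where
  "closed_unit_ball X = {x \<in> points X. qnorm X x \<le> 1}"

definition bounded_operators ::
    "('k, 'v::ab_group_add) space_data \<Rightarrow> ('k, 'w::ab_group_add) space_data \<Rightarrow> ('v \<Rightarrow> 'w) set" where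
  "bounded_operators X Y = {T.
     (\<forall>x\<in>points X. T x \<in> points Y) \<and>
     (\<forall>x\<in>points X. \<forall>y\<in>points X. T (x + y) = T x + T y) \<and>
     (\<forall>c. \<forall>x\<in>points X. T (smul X c x) = smul Y c (T x)) \<and>
     (\<exists>K. \<forall>x\<in>points X. qnorm Y (T x) \<le> K * qnorm X x)}"

definition operator_norm ::
    "('k, 'v) space_data \<Rightarrow> ('k, 'w) space_data \<Rightarrow> ('v \<Rightarrow> 'w) \<Rightarrow> real" where
  "operator_norm X Y T = (SUP x\<in>closed_unit_ball X. qnorm Y (T x))"

text \<open>
  The library's \<open>dim\<close> is \<open>0\<close> on infinite-dimensional sets, so that case has to be
  separated.
\<close>

definition operator_rank ::
    "('k::field, 'v) space_data \<Rightarrow> ('k, 'w::ab_group_add) space_data \<Rightarrow> ('v \<Rightarrow> 'w) \<Rightarrow> enat" where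
  "operator_rank X Y S =
     (if \<exists>B. finite B \<and> S ` points X \<subseteq> module.span (smul Y) B
      then enat (vector_space.dim (smul Y) (S ` points X)) else \<infinity>)"

definition entropy_number ::
    "('k::real_normed_field, 'v) space_data \<Rightarrow> ('k, 'w::ab_group_add) space_data \<Rightarrow>
     ('v \<Rightarrow> 'w) \<Rightarrow> nat \<Rightarrow> real" where
  "entropy_number X Y T n = Inf {\<epsilon>. \<epsilon> > 0 \<and>
     (\<exists>y :: nat \<Rightarrow> 'w. (\<forall>i\<in>{1..2 ^ (n - 1)}. y i \<in> points Y) \<and>
        T ` closed_unit_ball X \<subseteq>
          (\<Union>i\<in>{1..2 ^ (n - 1)}. {y i + smul Y (of_real \<epsilon>) z | z. z \<in> closed_unit_ball Y}))}"

definition approximation_number ::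
    "('k::field, 'v::ab_group_add) space_data \<Rightarrow> ('k, 'w::ab_group_add) space_data \<Rightarrow>
     ('v \<Rightarrow> 'w) \<Rightarrow> nat \<Rightarrow> real" where
  "approximation_number X Y T n =
     Inf {operator_norm X Y (\<lambda>x. T x - S x) | S.
            S \<in> bounded_operators X Y \<and> operator_rank X Y S < enat n}"

end

theory Submission
  imports Defs
begin

text \<open>
  The inequality between entropy numbers and means of approximation numbers goes back to Carl.
  Write \<open>T = S + (T - S)\<close> with \<open>S\<close> of small rank and \<open>T - S\<close> of small norm: the image of the
  unit ball under \<open>S\<close> can be covered by few balls, and \<open>T - S\<close> enlarges the radius by its norm.

  The finite-rank input is that the unit ball of a space spanned by \<open>m\<close> vectors contains at most
  \<open>(8 C\<^sup>3 / \<epsilon>)\<close> to the power \<open>2 m\<close> points that are \<open>\<epsilon>\<close>-separated, for \<open>\<epsilon> \<le> 1\<close>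
  (\<open>separated_card_le\<close>). A quasi-norm need not be continuous, so the proof does not measure
  balls but counts long expansions \<open>\<Sum>\<^sub>s l\<^sup>s x\<^sub>s\<close> with digits in the separated set; a
  maximal separated set is then a set of centres (\<open>span_ball_covered\<close>).

  For the inequality, one approximation is not enough: nearly best approximations \<open>S\<^sub>j\<close> of rank
  below \<open>2\<^sup>j\<close> are used for all dyadic levels up to the order of \<open>n\<close>, and \<open>T\<close> is the sum of the
  differences \<open>S\<^sub>j\<^sub>+\<^sub>1 - S\<^sub>j\<close> and a remainder. Their norms are of the order of the approximation
  numbers at \<open>2\<^sup>j\<close>, which may exceed the mean at \<open>n\<close> at most by the factor \<open>(n / 2\<^sup>j)\<^bsup>1/p\<^esup>\<close>. As
  the differences of low index have small rank, they can be covered much more finely at no cost,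
  and this gain, exponential in the
  entropy index per dimension, outweighs both that factor
  and the constants of the repeated quasi-triangle inequality (\<open>dyadic_covering\<close>,
  \<open>entropy_number_le_mean\<close>).

  For the limits, \<open>n\<close> is fixed: the image under one approximation of rank below \<open>n\<close> is covered
  by finitely many balls of arbitrarily small radius, so the limit of the entropy numbers is at
  most the approximation error, up to the price of adding a small radius to a large one. This
  price is the factor \<open>C\<close> in general (\<open>lim_entropy_le_const\<close>) and vanishes for an \<open>r\<close>-norm
  (\<open>lim_entropy_le_if_r_norm\<close>).
\<close>

section \<open>Scalars and reals\<close>

text \<open>
  Removes the constants of an estimate that is stable under taking powers.
\<close>

lemma le_if_powers_le:
  fixes a b K :: real
  assumes "0 < b" and le: "\<And>t. a ^ t \<le> K * b ^ t"
  shows "a \<le> b"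
proof (rule ccontr)
  assume "\<not> a \<le> b"
  then have "1 < a / b" using \<open>0 < b\<close> by simp
  then obtain t where "K < (a / b) ^ t" using real_arch_pow by blast
  then show False using le[of t] \<open>0 < b\<close> by (simp add: power_divide field_simps)
qed

text \<open>
  Real and imaginary part, with imaginary part \<open>0\<close> for real scalars; these inequalities are what
  is needed to sort scalars into small cells, and they treat both fields alike.
\<close>

lemma scalar_coordinates:
  obtains re im :: "'k::real_or_complex \<Rightarrow> real"
  where "\<And>z. \<bar>re z\<bar> \<le> norm z" "\<And>z. \<bar>im z\<bar> \<le> norm z"
    and "\<And>z w. norm (z - w) \<le> \<bar>re z - re w\<bar> + \<bar>im z - im w\<bar>"
proof (cases "\<forall>z::'k. \<exists>a. z = a *\<^sub>R 1")
  case True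
  then obtain re where re: "\<And>z::'k. z = re z *\<^sub>R 1" by metis
  have "norm (z - w) = \<bar>re z - re w\<bar>" for z w
  proof -
    have "z - w = (re z - re w) *\<^sub>R 1"
      by (subst re[of z], subst re[of w]) (simp add: scaleR_diff_left)
    then show ?thesis by simp
  qed
  moreover have "\<bar>re z\<bar> = norm z" for z by (subst (2) re[of z]) simp
  ultimately show thesis using that[of re "\<lambda>_. 0"] by simp
next
  case False
  with real_or_complex obtain i :: 'k where i: "i * i = - 1"
    and "\<forall>z. \<exists>a b. z = a *\<^sub>R 1 + b *\<^sub>R i \<and> norm z = cmod (Complex a b)" by blast
  then obtain re im where z: "\<And>z. z = re z *\<^sub>R 1 + im z *\<^sub>R i"
    and n: "\<And>z. norm z = cmod (Complex (re z) (im z))" by metis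
  have "norm i * norm i = 1" using i by (metis norm_minus_cancel norm_mult norm_one)
  then have "norm i = 1"
    by (metis abs_norm_cancel real_sqrt_abs2 real_sqrt_one)
  have "norm (z - w) \<le> \<bar>re z - re w\<bar> + \<bar>im z - im w\<bar>" for z w
  proof -
    have "z - w = (re z - re w) *\<^sub>R 1 + (im z - im w) *\<^sub>R i"
      by (subst z[of z], subst z[of w]) (simp add: scaleR_diff_left)
    then show ?thesis
      using norm_triangle_ineq[of "(re z - re w) *\<^sub>R (1::'k)" "(im z - im w) *\<^sub>R i"]
        \<open>norm i = 1\<close> by simp
  qed
  moreover have "\<bar>re z\<bar> \<le> norm z" "\<bar>im z\<bar> \<le> norm z" for z
    using abs_Re_le_cmod[of "Complex (re z) (im z)"] abs_Im_le_cmod[of "Complex (re z) (im z)"] n[of z]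
    by simp_all
  ultimately show thesis using that by blast
qed

lemma floor_eq_imp_close:
  fixes x y \<eta> :: real
  assumes "0 < \<eta>" "\<lfloor>x / \<eta>\<rfloor> = \<lfloor>y / \<eta>\<rfloor>"
  shows "\<bar>x - y\<bar> < \<eta>"
proof -
  have "\<bar>x / \<eta> - y / \<eta>\<bar> < 1" using assms(2) by linarith
  then have "\<bar>x - y\<bar> / \<eta> < 1" using assms(1)
    by (metis abs_divide abs_of_pos diff_divide_distrib)
  then show ?thesis using assms(1) by simp
qed

section \<open>Coverings in quasi-normed spaces\<close>

text \<open>
  The relation behind entropy numbers, with the number of balls and the radius as independent
  parameters: coverings of sums multiply the former and add the latter, and the centres form a
  set, so no enumeration has to be carried along.
\<close>

definition covered_by ::
    "('k, 'v::ab_group_add) space_data \<Rightarrow> 'v set \<Rightarrow> nat \<Rightarrow> real \<Rightarrow> bool" where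
  "covered_by Y A m \<epsilon> \<longleftrightarrow> (\<exists>F. finite F \<and> F \<subseteq> points Y \<and> card F \<le> m \<and>
     (\<forall>a\<in>A. \<exists>y\<in>F. qnorm Y (a - y) \<le> \<epsilon>))"

lemma covered_by_mono:
  assumes "covered_by Y A m \<epsilon>" "m \<le> m'" "\<epsilon> \<le> \<epsilon>'"
  shows "covered_by Y A m' \<epsilon>'"
  using assms unfolding covered_by_def by (meson order_trans)

lemma (in vector_space) finite_spanning_subset:
  assumes "finite B" "V \<subseteq> span B"
  obtains G where "G \<subseteq> V" "finite G" "card G = dim V" "V \<subseteq> span G"
  using assms basis_exists[of V] independent_span_bound[of B]
  by (metis order_trans)

context quasi_normed_space
begin

lemma points_add: "x \<in> points X \<Longrightarrow> y \<in> points X \<Longrightarrow> x + y \<in> points X"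
  using points_subspace by (simp add: subspace_add)

lemma points_diff: "x \<in> points X \<Longrightarrow> y \<in> points X \<Longrightarrow> x - y \<in> points X"
  using points_subspace by (simp add: subspace_diff)

lemma points_smul: "x \<in> points X \<Longrightarrow> smul X c x \<in> points X"
  using points_subspace by (simp add: subspace_scale)

lemma points_0: "0 \<in> points X"
  using points_subspace by (simp add: subspace_0)

lemma qnorm_0: "qnorm X 0 = 0"
  using qnorm_eq_0_iff[OF points_0] by simp

lemma qnorm_minus:
  assumes "x \<in> points X"
  shows "qnorm X (- x) = qnorm X x"
  using qnorm_smul[OF assms, of "-1"] by simp

lemma qnorm_minus_commute:
  assumes "x \<in> points X" "y \<in> points X"
  shows "qnorm X (x - y) = qnorm X (y - x)"
  using qnorm_minus[OF points_diff[OF assms]] by simp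

lemma qnorm_diff:
  assumes "x \<in> points X" "y \<in> points X"
  shows "qnorm X (x - y) \<le> C * (qnorm X x + qnorm X y)"
  using qnorm_add[of x "- y"] qnorm_minus[of y] assms points_diff[OF points_0, of y] by simp

lemma covered_by_sum:
  assumes f: "\<And>x. x \<in> I \<Longrightarrow> f x \<in> points X" and g: "\<And>x. x \<in> I \<Longrightarrow> g x \<in> points X"
    and cf: "covered_by X (f ` I) m \<epsilon>" and cg: "covered_by X (g ` I) k \<delta>"
  shows "covered_by X ((\<lambda>x. f x + g x) ` I) (m * k) (C * (\<epsilon> + \<delta>))"
proof -
  obtain F where F: "finite F" "F \<subseteq> points X" "card F \<le> m"
    "\<And>x. x \<in> I \<Longrightarrow> \<exists>y\<in>F. qnorm X (f x - y) \<le> \<epsilon>"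
    using cf unfolding covered_by_def by blast
  obtain G where G: "finite G" "G \<subseteq> points X" "card G \<le> k"
    "\<And>x. x \<in> I \<Longrightarrow> \<exists>y\<in>G. qnorm X (g x - y) \<le> \<delta>"
    using cg unfolding covered_by_def by blast
  let ?H = "(\<lambda>(y, z). y + z) ` (F \<times> G)"
  have "card ?H \<le> card (F \<times> G)" using F G by (intro card_image_le) simp
  also have "\<dots> \<le> m * k" using F G by (simp add: card_cartesian_product mult_le_mono)
  finally have "card ?H \<le> m * k" .
  moreover have "?H \<subseteq> points X" using F(2) G(2) by (auto intro!: points_add)
  moreover have "\<exists>w\<in>?H. qnorm X (f x + g x - w) \<le> C * (\<epsilon> + \<delta>)" if x: "x \<in> I" for x
  proof -
    obtain y z where y: "y \<in> F" "qnorm X (f x - y) \<le> \<epsilon>" and z: "z \<in> G" "qnorm X (g x - z) \<le> \<delta>"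
      using F(4)[OF x] G(4)[OF x] by blast
    have "f x - y \<in> points X" "g x - z \<in> points X"
      using y z F(2) G(2) f[OF x] g[OF x] by (auto intro: points_diff)
    from qnorm_add[OF this]
    have "qnorm X (f x + g x - (y + z)) \<le> C * (qnorm X (f x - y) + qnorm X (g x - z))"
      by (simp add: algebra_simps)
    also have "\<dots> \<le> C * (\<epsilon> + \<delta>)" using y z const_ge_1 by (intro mult_left_mono) auto
    finally show ?thesis using y z by force
  qed
  ultimately show ?thesis unfolding covered_by_def using F(1) G(1)
    by (intro exI[of _ ?H]) auto
qed

text \<open>
  Turns closeness of coefficients into closeness of vectors in the span of \<open>G\<close>.
\<close>

lemma qnorm_combination_le:
  assumes "finite G" "G \<subseteq> points X"
  shows "\<exists>H>0. \<forall>u \<tau>. 0 \<le> \<tau> \<longrightarrow> (\<forall>b\<in>G. norm (u b) \<le> \<tau>) \<longrightarrow>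
    qnorm X (\<Sum>b\<in>G. smul X (u b) b) \<le> H * \<tau>"
  using assms
proof (induction G rule: finite_induct)
  case empty
  then show ?case by (auto simp: qnorm_0 intro!: exI[of _ 1])
next
  case (insert x G)
  then obtain H where H: "H > 0" and le: "\<And>u \<tau>. 0 \<le> \<tau> \<Longrightarrow> (\<forall>b\<in>G. norm (u b) \<le> \<tau>) \<Longrightarrow>
    qnorm X (\<Sum>b\<in>G. smul X (u b) b) \<le> H * \<tau>" by auto
  have "qnorm X (\<Sum>b\<in>insert x G. smul X (u b) b) \<le> (C * (qnorm X x + H)) * \<tau>"
    if \<tau>: "0 \<le> \<tau>" and u: "\<forall>b\<in>insert x G. norm (u b) \<le> \<tau>" for u \<tau>
  proof -
    have x: "x \<in> points X" using insert by simp
    have "(\<Sum>b\<in>G. smul X (u b) b) \<in> points X"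
      using insert.prems points_subspace by (intro subspace_sum) (auto intro: points_smul)
    from qnorm_add[OF points_smul[OF x] this, of "u x"]
    have "qnorm X (\<Sum>b\<in>insert x G. smul X (u b) b)
      \<le> C * (norm (u x) * qnorm X x + qnorm X (\<Sum>b\<in>G. smul X (u b) b))"
      using insert.hyps by (simp add: qnorm_smul[OF x])
    also have "\<dots> \<le> C * (\<tau> * qnorm X x + H * \<tau>)"
      using u \<tau> const_ge_1 qnorm_nonneg[OF x] le[OF \<tau>, of u]
      by (intro mult_left_mono add_mono mult_right_mono) auto
    finally show ?thesis by (simp add: algebra_simps)
  qed
  moreover have "C * (qnorm X x + H) > 0"
    using const_ge_1 H qnorm_nonneg[of x] insert.prems by (intro mult_pos_pos) auto
  ultimately show ?case by blast
qed

end

section \<open>A packing bound in finite-dimensional subspaces\<close>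

text \<open>
  \<open>\<Sum>\<^sub>s l\<^sup>s x\<^sub>s\<close>: the vectors of the list are the digits of an expansion in base \<open>1 / l\<close>.
\<close>

primrec expansion :: "('k::real_or_complex, 'v::ab_group_add) space_data \<Rightarrow> real \<Rightarrow> 'v list \<Rightarrow> 'v" where
  "expansion X l [] = 0"
| "expansion X l (x # xs) = x + smul X (of_real l) (expansion X l xs)"

context quasi_normed_space
begin

lemma expansion_in_points: "set xs \<subseteq> points X \<Longrightarrow> expansion X l xs \<in> points X"
  by (induction xs) (auto intro: points_add points_smul points_0)

lemma expansion_diff_Cons:
  "expansion X l (x # xs) - expansion X l (y # ys)
    = (x - y) + smul X (of_real l) (expansion X l xs - expansion X l ys)"
  by (simp add: scale_right_diff_distrib)

text \<open>
  The bound \<open>4 C\<^sup>2\<close> reproduces itself: the heads contribute at most \<open>2 C\<^sup>2\<close> and the tails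
  \<open>C l \<cdot> 4 C\<^sup>2\<close>, which is at most \<open>1 / 2\<close>.
\<close>

lemma expansion_diff_le:
  assumes F: "F \<subseteq> points X" "\<And>x. x \<in> F \<Longrightarrow> qnorm X x \<le> 1"
    and l: "0 < l" "8 * C ^ 3 * l \<le> 1"
  shows "length xs = length ys \<Longrightarrow> set xs \<subseteq> F \<Longrightarrow> set ys \<subseteq> F \<Longrightarrow>
    qnorm X (expansion X l xs - expansion X l ys) \<le> 4 * C ^ 2"
proof (induction xs ys rule: list_induct2)
  case Nil
  then show ?case by (simp add: qnorm_0)
next
  case (Cons x xs y ys)
  have xy: "x \<in> points X" "y \<in> points X" and
    e: "expansion X l xs - expansion X l ys \<in> points X" (is "?e \<in> _")
    using Cons.prems F(1) by (auto intro!: points_diff expansion_in_points)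
  have "qnorm X (x - y) \<le> C * (1 + 1)"
    using qnorm_diff[OF xy] F(2)[of x] F(2)[of y] Cons.prems const_ge_1
    by (smt (verit) list.set_intros(1) mult_left_mono subsetD)
  moreover have "qnorm X (smul X (of_real l) ?e) \<le> l * (4 * C ^ 2)"
    using Cons l by (simp add: qnorm_smul[OF e])
  ultimately have "qnorm X (expansion X l (x # xs) - expansion X l (y # ys)) \<le>
      C * (C * (1 + 1) + l * (4 * C ^ 2))"
    unfolding expansion_diff_Cons
    using qnorm_add[OF points_diff[OF xy] points_smul[OF e], of "of_real l"] const_ge_1
    by (smt (verit) mult_left_mono)
  also have "\<dots> = 2 * C ^ 2 + (8 * C ^ 3 * l) / 2" by (simp add: power2_eq_square power3_eq_cube algebra_simps)
  also have "\<dots> \<le> 4 * C ^ 2" using l(2) one_le_power[OF const_ge_1, of 2] by linarith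
  finally show ?case .
qed

text \<open>
  The first differing digit decides: at its position the difference is at least about \<open>\<epsilon>\<close>, while
  all later digits together change the sum by at most \<open>l \<cdot> 4 C\<^sup>2\<close>, which \<open>l\<close> is chosen small
  enough not to compensate.
\<close>

lemma expansion_separated:
  assumes F: "F \<subseteq> points X" "\<And>x. x \<in> F \<Longrightarrow> qnorm X x \<le> 1"
    and sep: "\<And>x y. x \<in> F \<Longrightarrow> y \<in> F \<Longrightarrow> x \<noteq> y \<Longrightarrow> \<epsilon> < qnorm X (x - y)"
    and \<epsilon>: "0 < \<epsilon>" "\<epsilon> \<le> 1" and l: "0 < l" "8 * C ^ 3 * l \<le> \<epsilon>"
  shows "length xs = length ys \<Longrightarrow> set xs \<subseteq> F \<Longrightarrow> set ys \<subseteq> F \<Longrightarrow> xs \<noteq> ys \<Longrightarrow>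
    l ^ length xs * (\<epsilon> / (2 * C)) \<le> qnorm X (expansion X l xs - expansion X l ys)"
proof (induction xs ys rule: list_induct2)
  case Nil
  then show ?case by simp
next
  case (Cons x xs y ys)
  have l1: "l \<le> 1"
    using l \<epsilon> one_le_power[OF const_ge_1, of 3] mult_right_mono[of 1 "8 * C ^ 3" l] by linarith
  have C: "C > 0" using const_ge_1 by linarith
  have xy: "x \<in> points X" "y \<in> points X" and
    e: "expansion X l xs - expansion X l ys \<in> points X" (is "?e \<in> _")
    using Cons.prems F(1) by (auto intro!: points_diff expansion_in_points)
  show ?case
  proof (cases "x = y")
    case True
    then have "xs \<noteq> ys" using Cons.prems by simp
    then have "l ^ length xs * (\<epsilon> / (2 * C)) \<le> qnorm X ?e" using Cons by simp
    then have "l * (l ^ length xs * (\<epsilon> / (2 * C))) \<le> l * qnorm X ?e"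
      by (rule mult_left_mono) (use l in simp)
    moreover have "qnorm X (expansion X l (x # xs) - expansion X l (y # ys)) = l * qnorm X ?e"
      unfolding expansion_diff_Cons using True l(1) by (simp add: qnorm_smul[OF e])
    ultimately show ?thesis by (simp add: mult.assoc)
  next
    case False
    let ?d = "expansion X l (x # xs) - expansion X l (y # ys)"
    have d: "?d \<in> points X"
      unfolding expansion_diff_Cons by (intro points_add points_smul e points_diff[OF xy])
    have "\<epsilon> < qnorm X (x - y)" using sep False Cons.prems by simp
    also have "x - y = ?d - smul X (of_real l) ?e" unfolding expansion_diff_Cons by simp
    also have "qnorm X \<dots> \<le> C * (qnorm X ?d + qnorm X (smul X (of_real l) ?e))"
      by (rule qnorm_diff[OF d points_smul[OF e]])
    also have "\<dots> \<le> C * (qnorm X ?d + l * (4 * C ^ 2))"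
      using expansion_diff_le[OF F, of l xs ys] l \<epsilon> Cons C
      by (intro mult_left_mono add_left_mono) (auto simp: qnorm_smul[OF e])
    also have "\<dots> = C * qnorm X ?d + (8 * C ^ 3 * l) / 2"
      by (simp add: power2_eq_square power3_eq_cube algebra_simps)
    finally have "\<epsilon> / 2 \<le> C * qnorm X ?d" using l(2) by linarith
    then have "\<epsilon> / (2 * C) \<le> qnorm X ?d" using C by (simp add: field_simps)
    moreover have "l ^ length (x # xs) * (\<epsilon> / (2 * C)) \<le> 1 * (\<epsilon> / (2 * C))"
      using l l1 \<epsilon> C by (intro mult_right_mono power_le_one) auto
    ultimately show ?thesis by linarith
  qed
qed

text \<open>
  The coefficients of the digits form expansions in base \<open>1 / l\<close> themselves, so a geometric
  series bounds them independently of the length.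
\<close>

lemma expansion_coefficients:
  assumes "finite G" "finite F" "F \<subseteq> span G" "0 < l" "l \<le> 1 / 2"
  obtains cf M where "0 < M"
    "\<And>xs. set xs \<subseteq> F \<Longrightarrow> expansion X l xs = (\<Sum>b\<in>G. smul X (cf xs b) b)"
    "\<And>xs b. set xs \<subseteq> F \<Longrightarrow> b \<in> G \<Longrightarrow> norm (cf xs b) \<le> M"
proof -
  have "\<exists>u. x = (\<Sum>b\<in>G. smul X (u b) b)" if "x \<in> F" for x
    using that assms(1,3) by (auto simp: span_finite)
  then obtain c where c: "\<And>x. x \<in> F \<Longrightarrow> x = (\<Sum>b\<in>G. smul X (c x b) b)" by metis
  define M where "M = 1 + (\<Sum>x\<in>F. \<Sum>b\<in>G. norm (c x b))"
  have cM: "norm (c x b) \<le> M" if "x \<in> F" "b \<in> G" for x b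
  proof -
    have "norm (c x b) \<le> (\<Sum>b\<in>G. norm (c x b))"
      using that assms(1) by (intro member_le_sum) auto
    also have "\<dots> \<le> (\<Sum>x\<in>F. \<Sum>b\<in>G. norm (c x b))"
      using that assms(2) by (intro member_le_sum[of x F "\<lambda>x. \<Sum>b\<in>G. norm (c x b)"]) (auto intro: sum_nonneg)
    finally show ?thesis unfolding M_def by simp
  qed
  have "1 \<le> M" unfolding M_def by (simp add: sum_nonneg)
  define cf where "cf xs b = foldr (\<lambda>x r. c x b + of_real l * r) xs 0" for xs b
  have [simp]: "cf [] b = 0" "cf (x # xs) b = c x b + of_real l * cf xs b" for x xs b
    unfolding cf_def by simp_all
  show thesis
  proof (rule that[of "2 * M" cf])
    show "0 < 2 * M" using \<open>1 \<le> M\<close> by simp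
    show "set xs \<subseteq> F \<Longrightarrow> expansion X l xs = (\<Sum>b\<in>G. smul X (cf xs b) b)" for xs
    proof (induction xs)
      case (Cons x xs)
      then show ?case using c[of x]
        by (simp add: scale_left_distrib sum.distrib scale_sum_right)
    qed simp
    show "norm (cf xs b) \<le> 2 * M" if "set xs \<subseteq> F" "b \<in> G" for xs b
      using that(1)
    proof (induction xs)
      case Nil
      then show ?case using \<open>1 \<le> M\<close> by simp
    next
      case (Cons x xs)
      have "norm (cf (x # xs) b) \<le> norm (c x b) + norm (of_real l * cf xs b)"
        by (simp add: norm_triangle_ineq)
      also have "\<dots> = norm (c x b) + l * norm (cf xs b)" using assms(4) by (simp add: norm_mult)
      also have "\<dots> \<le> M + 1 / 2 * (2 * M)"
        using Cons that cM[of x b] assms(4,5) \<open>1 \<le> M\<close>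
        by (intro add_mono mult_mono) auto
      finally show ?case by simp
    qed
  qed
qed

text \<open>
  Volume comparison is replaced by counting expansions of length \<open>t\<close> with digits in \<open>F\<close>: there
  are \<open>card F\<close> to the power \<open>t\<close> of them, and they are separated by a multiple of \<open>l\<^sup>t\<close>. Two of
  them whose coefficients lie in the same cells of side \<open>\<eta>\<close>, a small multiple of \<open>l\<^sup>t\<close>, are
  therefore equal, and there are only \<open>K\<close> times \<open>(1 / l)\<^sup>t\<close> cells for each of the \<open>2 card G\<close>
  real coordinates. The constant \<open>K\<close> depends on \<open>F\<close> and \<open>G\<close>, but it disappears on taking \<open>t\<close>-th
  roots and letting \<open>t\<close> tend to infinity.
\<close>

lemma separated_card_le:
  assumes G: "finite G" "G \<subseteq> points X" and F: "finite F" "F \<subseteq> span G" "\<And>x. x \<in> F \<Longrightarrow> qnorm X x \<le> 1"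
    and sep: "\<And>x y. x \<in> F \<Longrightarrow> y \<in> F \<Longrightarrow> x \<noteq> y \<Longrightarrow> \<epsilon> < qnorm X (x - y)"
    and \<epsilon>: "0 < \<epsilon>" "\<epsilon> \<le> 1" and l: "0 < l" "8 * C ^ 3 * l \<le> \<epsilon>"
  shows "real (card F) \<le> (1 / l) ^ (2 * card G)"
proof -
  have C: "C > 0" using const_ge_1 by linarith
  have l1: "l \<le> 1 / 2"
    using l \<epsilon> one_le_power[OF const_ge_1, of 3] mult_right_mono[of 2 "8 * C ^ 3" l] by linarith
  have Fp: "F \<subseteq> points X" using F(2) span_minimal[OF G(2) points_subspace] by blast
  obtain re im :: "'k \<Rightarrow> real" where re: "\<And>z. \<bar>re z\<bar> \<le> norm z" and im: "\<And>z. \<bar>im z\<bar> \<le> norm z"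
    and ri: "\<And>z w. norm (z - w) \<le> \<bar>re z - re w\<bar> + \<bar>im z - im w\<bar>"
    by (rule scalar_coordinates) blast
  obtain cf M where M: "0 < M" and
    cf: "\<And>xs. set xs \<subseteq> F \<Longrightarrow> expansion X l xs = (\<Sum>b\<in>G. smul X (cf xs b) b)" and
    cfM: "\<And>xs b. set xs \<subseteq> F \<Longrightarrow> b \<in> G \<Longrightarrow> norm (cf xs b) \<le> M"
    by (rule expansion_coefficients[OF G(1) F(1,2) l(1) l1]) blast
  obtain H where H: "H > 0" and comb: "\<And>u \<tau>. 0 \<le> \<tau> \<Longrightarrow> (\<forall>b\<in>G. norm (u b) \<le> \<tau>) \<Longrightarrow>
    qnorm X (\<Sum>b\<in>G. smul X (u b) b) \<le> H * \<tau>"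
    using qnorm_combination_le[OF G] by blast
  \<comment> \<open>Cells of side \<open>l\<^sup>t d\<close> have image diameter at most \<open>l\<^sup>t \<epsilon> / (4 C)\<close>, half of the separation.\<close>
  define d where "d = \<epsilon> / (8 * C * H)"
  have d: "d > 0" unfolding d_def using \<epsilon> C H by simp
  define K where "K = 2 * M / d + 5"
  have "real (card F) ^ t \<le> K ^ (2 * card G) * ((1 / l) ^ (2 * card G)) ^ t" for t
  proof -
    define \<eta> where "\<eta> = l ^ t * d"
    have \<eta>: "\<eta> > 0" unfolding \<eta>_def using l d by simp
    define N where "N = \<lceil>M / \<eta>\<rceil> + 1"
    define words where "words = {xs. set xs \<subseteq> F \<and> length xs = t}"
    define cell where "cell xs = (\<lambda>b\<in>G. (\<lfloor>re (cf xs b) / \<eta>\<rfloor>, \<lfloor>im (cf xs b) / \<eta>\<rfloor>))" for xs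
    have range: "\<lfloor>x / \<eta>\<rfloor> \<in> {- N..N}" if "\<bar>x\<bar> \<le> M" for x
    proof -
      have "\<bar>x / \<eta>\<bar> \<le> M / \<eta>" using that \<eta> by (simp add: divide_right_mono)
      then have "x / \<eta> \<le> M / \<eta>" "- (M / \<eta>) \<le> x / \<eta>" by linarith+
      moreover have "M / \<eta> \<le> of_int \<lceil>M / \<eta>\<rceil>" by simp
      ultimately have "x / \<eta> \<le> of_int \<lceil>M / \<eta>\<rceil>" "of_int (- \<lceil>M / \<eta>\<rceil>) \<le> x / \<eta>" by linarith+
      then have "\<lfloor>x / \<eta>\<rfloor> \<le> \<lceil>M / \<eta>\<rceil>" "- \<lceil>M / \<eta>\<rceil> \<le> \<lfloor>x / \<eta>\<rfloor>" by linarith+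
      then show ?thesis unfolding N_def by simp
    qed
    have "inj_on cell words"
    proof (rule inj_onI, rule ccontr)
      fix xs ys assume xs: "xs \<in> words" and ys: "ys \<in> words" and eq: "cell xs = cell ys" and "xs \<noteq> ys"
      have "norm (cf xs b - cf ys b) \<le> 2 * \<eta>" if "b \<in> G" for b
      proof -
        have "\<lfloor>re (cf xs b) / \<eta>\<rfloor> = \<lfloor>re (cf ys b) / \<eta>\<rfloor>" "\<lfloor>im (cf xs b) / \<eta>\<rfloor> = \<lfloor>im (cf ys b) / \<eta>\<rfloor>"
          using fun_cong[OF eq, of b] that unfolding cell_def by simp_all
        from this[THEN floor_eq_imp_close[OF \<eta>]] show ?thesis
          using ri[of "cf xs b" "cf ys b"] by linarith
      qed
      then have "qnorm X (\<Sum>b\<in>G. smul X (cf xs b - cf ys b) b) \<le> H * (2 * \<eta>)"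
        using \<eta> by (intro comb) auto
      moreover have "expansion X l xs - expansion X l ys = (\<Sum>b\<in>G. smul X (cf xs b - cf ys b) b)"
        using xs ys unfolding words_def by (simp add: cf scale_left_diff_distrib sum_subtractf)
      moreover have "l ^ t * (\<epsilon> / (2 * C)) \<le> qnorm X (expansion X l xs - expansion X l ys)"
        using expansion_separated[OF Fp F(3) sep \<epsilon> l, of xs ys] xs ys \<open>xs \<noteq> ys\<close>
        unfolding words_def by auto
      ultimately have "l ^ t * (\<epsilon> / (2 * C)) \<le> H * (2 * \<eta>)" by simp
      also have "\<dots> = l ^ t * (\<epsilon> / (4 * C))" unfolding \<eta>_def d_def using H C by (simp add: field_simps)
      finally have "\<epsilon> / (2 * C) \<le> \<epsilon> / (4 * C)"
        by (rule mult_left_le_imp_le) (use l in simp)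
      then show False using \<epsilon> C by (simp add: field_simps)
    qed
    moreover have "cell ` words \<subseteq> (\<Pi>\<^sub>E b\<in>G. {- N..N} \<times> {- N..N})"
    proof (rule image_subsetI)
      fix xs assume "xs \<in> words"
      then have "norm (cf xs b) \<le> M" if "b \<in> G" for b
        using cfM that unfolding words_def by simp
      then have "\<bar>re (cf xs b)\<bar> \<le> M" "\<bar>im (cf xs b)\<bar> \<le> M" if "b \<in> G" for b
        using that re im order_trans by blast+
      then show "cell xs \<in> (\<Pi>\<^sub>E b\<in>G. {- N..N} \<times> {- N..N})"
        unfolding cell_def using range by auto
    qed
    moreover have "finite (\<Pi>\<^sub>E b\<in>G. {- N..N} \<times> {- N..N})" using G(1) by (intro finite_PiE) auto
    ultimately have "card words \<le> card (\<Pi>\<^sub>E b\<in>G. {- N..N} \<times> {- N..N})"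
      using card_inj_on_le by blast
    also have "\<dots> = (nat (2 * N + 1) * nat (2 * N + 1)) ^ card G"
      using G(1) by (simp add: card_PiE card_cartesian_product)
    also have "\<dots> = nat (2 * N + 1) ^ (2 * card G)"
      by (simp add: power2_eq_square power_mult)
    finally have "real (card F ^ t) \<le> real (nat (2 * N + 1) ^ (2 * card G))"
      unfolding words_def card_lists_length_eq[OF F(1)] by (simp only: of_nat_le_iff)
    also have "\<dots> = real (nat (2 * N + 1)) ^ (2 * card G)" by simp
    also have "\<dots> \<le> (K * (1 / l) ^ t) ^ (2 * card G)"
    proof (rule power_mono)
      have "M / \<eta> > 0" using M \<eta> by simp
      then have "real (nat (2 * N + 1)) \<le> 2 * M / \<eta> + 5" unfolding N_def by simp linarith
      also have "2 * M / \<eta> = 2 * M / d * (1 / l) ^ t" unfolding \<eta>_def by (simp add: field_simps power_divide)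
      also have "\<dots> + 5 \<le> 2 * M / d * (1 / l) ^ t + 5 * (1 / l) ^ t"
        using l l1 by (intro add_left_mono) (simp add: one_le_power)
      finally show "real (nat (2 * N + 1)) \<le> K * (1 / l) ^ t" unfolding K_def by (simp add: algebra_simps)
    qed simp
    also have "\<dots> = K ^ (2 * card G) * ((1 / l) ^ (2 * card G)) ^ t"
      by (simp only: power_mult_distrib power_mult[symmetric] mult.commute)
    finally show ?thesis by simp
  qed
  then show ?thesis by (rule le_if_powers_le[rotated]) (use l in simp)
qed

text \<open>
  The centres are a maximal \<open>\<epsilon>\<close>-separated subset of the unit ball of the span, scaled by \<open>\<rho>\<close>: a
  point at distance above \<open>\<epsilon>\<close> from all of them could be added. A maximal one exists by the
  packing bound.
\<close>

lemma span_ball_covered: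
  assumes G: "finite G" "G \<subseteq> points X" and A: "A \<subseteq> span G" "\<And>a. a \<in> A \<Longrightarrow> qnorm X a \<le> \<rho>"
    and \<rho>: "0 < \<rho>" and \<epsilon>: "0 < \<epsilon>" "\<epsilon> \<le> 1" and l: "0 < l" "8 * C ^ 3 * l \<le> \<epsilon>"
    and m: "(1 / l) ^ (2 * card G) \<le> real m"
  shows "covered_by X A m (\<rho> * \<epsilon>)"
proof -
  have Gp: "span G \<subseteq> points X" by (rule span_minimal[OF G(2) points_subspace])
  define P where "P F \<longleftrightarrow> finite F \<and> F \<subseteq> span G \<and> (\<forall>x\<in>F. qnorm X x \<le> 1) \<and>
    (\<forall>x\<in>F. \<forall>y\<in>F. x \<noteq> y \<longrightarrow> \<epsilon> < qnorm X (x - y))" for F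
  have Pm: "card F \<le> m" if "P F" for F
    using separated_card_le[OF G, of F \<epsilon> l] that \<epsilon> l m unfolding P_def by force
  have "P {}" unfolding P_def by simp
  then have "\<exists>F. P F \<and> (\<forall>F'. P F' \<longrightarrow> card F' \<le> card F)"
    by (rule ex_has_greatest_nat[of P _ card "Suc m"]) (auto dest: Pm simp: less_Suc_eq_le)
  then obtain F where F: "P F" and max: "\<And>F'. P F' \<Longrightarrow> card F' \<le> card F" by blast
  have net: "\<exists>y\<in>F. qnorm X (x - y) \<le> \<epsilon>" if x: "x \<in> span G" "qnorm X x \<le> 1" for x
  proof (rule ccontr)
    assume far: "\<not> ?thesis"
    then have "x \<notin> F" using \<epsilon> qnorm_0 by force
    moreover have "qnorm X (y - x) = qnorm X (x - y)" if "y \<in> F" for y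
      using that x F Gp unfolding P_def by (intro qnorm_minus_commute) auto
    then have "P (insert x F)" using F x far unfolding P_def by (auto simp: not_le)
    ultimately show False using max[of "insert x F"] F unfolding P_def by simp
  qed
  let ?s = "smul X (of_real \<rho>)"
  have "\<exists>y\<in>?s ` F. qnorm X (a - y) \<le> \<rho> * \<epsilon>" if a: "a \<in> A" for a
  proof -
    let ?x = "smul X (of_real (1 / \<rho>)) a"
    have as: "a \<in> span G" using a A(1) by blast
    then have "qnorm X ?x = qnorm X a / \<rho>" using Gp \<rho>
      by (subst qnorm_smul) (auto simp: norm_divide)
    then have "qnorm X ?x \<le> 1" using A(2)[OF a] \<rho> by simp
    with net[of ?x] as obtain y where y: "y \<in> F" "qnorm X (?x - y) \<le> \<epsilon>"
      by (auto intro: span_scale)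
    have p: "?x - y \<in> points X" using Gp as y F unfolding P_def
      by (meson points_diff points_smul subsetD)
    have "?s ?x = a" using \<rho> by (simp flip: of_real_mult)
    then have "a - ?s y = ?s (?x - y)" by (simp add: scale_right_diff_distrib)
    then have "qnorm X (a - ?s y) = \<rho> * qnorm X (?x - y)"
      using qnorm_smul[OF p, of "of_real \<rho>"] \<rho> by simp
    also have "\<dots> \<le> \<rho> * \<epsilon>" using y \<rho> by (intro mult_left_mono) auto
    finally show ?thesis using y by blast
  qed
  moreover have Ff: "finite F" "F \<subseteq> points X" using F Gp unfolding P_def by auto
  then have "card (?s ` F) \<le> m" using order_trans[OF card_image_le Pm[OF F]] by blast
  moreover have "?s ` F \<subseteq> points X" using Ff(2) by (auto intro: points_smul)
  moreover have "finite (?s ` F)" using Ff(1) by (rule finite_imageI)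
  ultimately show ?thesis unfolding covered_by_def by (intro exI[of _ "?s ` F"] conjI ballI)
qed

end

section \<open>Approximation numbers\<close>

locale bounded_operator =
  dom: quasi_normed_space X CX + quasi_normed_space Y C
  for X :: "('k::real_or_complex, 'v::ab_group_add) space_data"
    and Y :: "('k, 'w::ab_group_add) space_data" and CX C +
  fixes T :: "'v \<Rightarrow> 'w"
  assumes T: "T \<in> bounded_operators X Y"
begin

abbreviation "B \<equiv> closed_unit_ball X"
abbreviation "a \<equiv> approximation_number X Y T"
abbreviation "e \<equiv> entropy_number X Y T"

lemma ball_points: "x \<in> B \<Longrightarrow> x \<in> points X"
  unfolding closed_unit_ball_def by simp

lemma zero_in_ball: "0 \<in> B"
  unfolding closed_unit_ball_def by (simp add: dom.points_0 dom.qnorm_0)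

lemma T_points: "x \<in> points X \<Longrightarrow> T x \<in> points Y"
  using T unfolding bounded_operators_def by blast

lemma bounded_on_ball:
  assumes "S \<in> bounded_operators X Y"
  shows "\<exists>K. \<forall>x\<in>B. qnorm Y (S x) \<le> K"
proof -
  obtain K where K: "\<And>x. x \<in> points X \<Longrightarrow> qnorm Y (S x) \<le> K * qnorm X x"
    using assms unfolding bounded_operators_def by blast
  have "qnorm Y (S x) \<le> \<bar>K\<bar>" if x: "x \<in> B" for x
  proof -
    have "qnorm Y (S x) \<le> K * qnorm X x" by (rule K[OF ball_points[OF x]])
    also have "\<dots> \<le> \<bar>K\<bar> * 1"
      using x dom.qnorm_nonneg[OF ball_points[OF x]] unfolding closed_unit_ball_def
      by (intro mult_mono) auto
    finally show ?thesis by simp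
  qed
  then show ?thesis by blast
qed

lemma bdd_above_difference:
  assumes S: "S \<in> bounded_operators X Y"
  shows "bdd_above ((\<lambda>x. qnorm Y (T x - S x)) ` B)"
proof -
  obtain K L where K: "\<And>x. x \<in> B \<Longrightarrow> qnorm Y (T x) \<le> K" and L: "\<And>x. x \<in> B \<Longrightarrow> qnorm Y (S x) \<le> L"
    using bounded_on_ball[OF T] bounded_on_ball[OF S] by blast
  have "qnorm Y (T x - S x) \<le> C * (K + L)" if x: "x \<in> B" for x
  proof -
    have "S x \<in> points Y" using S ball_points[OF x] unfolding bounded_operators_def by blast
    from qnorm_diff[OF T_points[OF ball_points[OF x]] this]
    have "qnorm Y (T x - S x) \<le> C * (qnorm Y (T x) + qnorm Y (S x))" .
    also have "\<dots> \<le> C * (K + L)"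
      using K[OF x] L[OF x] const_ge_1 by (intro mult_left_mono add_mono) auto
    finally show ?thesis .
  qed
  then show ?thesis by (intro bdd_aboveI2)
qed

lemma le_operator_norm_difference:
  assumes "S \<in> bounded_operators X Y" "x \<in> B"
  shows "qnorm Y (T x - S x) \<le> operator_norm X Y (\<lambda>x. T x - S x)"
  unfolding operator_norm_def by (rule cSUP_upper[OF assms(2) bdd_above_difference[OF assms(1)]])

lemma operator_norm_difference_nonneg:
  assumes "S \<in> bounded_operators X Y"
  shows "0 \<le> operator_norm X Y (\<lambda>x. T x - S x)"
proof -
  have "T 0 - S 0 \<in> points Y"
    using T_points[OF dom.points_0] assms dom.points_0 unfolding bounded_operators_def
    by (intro points_diff) auto
  from qnorm_nonneg[OF this] show ?thesis
    using le_operator_norm_difference[OF assms zero_in_ball] by linarith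
qed

lemma zero_operator:
  assumes "1 \<le> n"
  shows "(\<lambda>x. 0) \<in> bounded_operators X Y \<and> operator_rank X Y (\<lambda>x. 0) < enat n"
proof -
  have "(\<lambda>x. 0::'w) ` points X = {0}" using dom.points_0 by auto
  moreover have "dim {0} = 0" using dim_eq_card_independent[OF independent_empty] dim_span[of "{}"] by simp
  moreover have "\<exists>B. finite B \<and> {0} \<subseteq> span B" by (rule exI[of _ "{}"]) simp
  ultimately have "operator_rank X Y (\<lambda>x. 0) = 0"
    unfolding operator_rank_def by (simp add: zero_enat_def)
  moreover have "(\<lambda>x. 0) \<in> bounded_operators X Y"
    unfolding bounded_operators_def using points_0 by (auto simp: qnorm_0 intro!: exI[of _ 0])
  ultimately show ?thesis using assms by (simp add: zero_enat_def)
qed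

lemma approximation_numbers_bdd_below:
  "bdd_below {operator_norm X Y (\<lambda>x. T x - S x) | S.
     S \<in> bounded_operators X Y \<and> operator_rank X Y S < enat n}"
  using operator_norm_difference_nonneg by (intro bdd_belowI[of _ 0]) blast

lemma approximation_numbers_nonempty:
  "1 \<le> n \<Longrightarrow> {operator_norm X Y (\<lambda>x. T x - S x) | S.
     S \<in> bounded_operators X Y \<and> operator_rank X Y S < enat n} \<noteq> {}"
  using zero_operator by blast

lemma approximation_number_nonneg: "1 \<le> n \<Longrightarrow> 0 \<le> a n"
  unfolding approximation_number_def
  using operator_norm_difference_nonneg by (intro cInf_greatest approximation_numbers_nonempty) auto

lemma approximation_number_antimono: "1 \<le> m \<Longrightarrow> m \<le> n \<Longrightarrow> a n \<le> a m"
  unfolding approximation_number_def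
  by (rule cInf_superset_mono[OF approximation_numbers_nonempty approximation_numbers_bdd_below])
    (use enat_ord_simps(1)[of m n] order.strict_trans2 in blast)+

text \<open>
  Covering arguments see the rank of \<open>S\<close> through a small set that spans its range.
\<close>

lemma near_best_approximation:
  assumes "1 \<le> n" "0 < \<delta>"
  obtains S G where "finite G" "G \<subseteq> points Y" "card G < n" "S ` points X \<subseteq> span G"
    "\<And>x. x \<in> B \<Longrightarrow> qnorm Y (T x - S x) \<le> a n + \<delta>"
proof -
  obtain S where S: "S \<in> bounded_operators X Y" and rank: "operator_rank X Y S < enat n"
    and close: "operator_norm X Y (\<lambda>x. T x - S x) < a n + \<delta>"
    using cInf_lessD[OF approximation_numbers_nonempty[OF assms(1)], of "a n + \<delta>"] assms(2)
    unfolding approximation_number_def by auto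
  have fin: "\<exists>B. finite B \<and> S ` points X \<subseteq> span B"
    using rank unfolding operator_rank_def by (auto split: if_splits)
  then have "dim (S ` points X) < n" using rank unfolding operator_rank_def by simp
  moreover obtain G where G: "G \<subseteq> S ` points X" "finite G" "card G = dim (S ` points X)"
    "S ` points X \<subseteq> span G" using fin finite_spanning_subset by metis
  moreover have "S ` points X \<subseteq> points Y" using S unfolding bounded_operators_def by blast
  moreover have "qnorm Y (T x - S x) \<le> a n + \<delta>" if "x \<in> B" for x
    using le_operator_norm_difference[OF S that] close by linarith
  ultimately show thesis using that[of G S] by auto
qed

section \<open>Entropy numbers\<close>

abbreviation "entropy_radii n \<equiv> {\<epsilon>. \<epsilon> > 0 \<and>
     (\<exists>y :: nat \<Rightarrow> 'w. (\<forall>i\<in>{1..2 ^ (n - 1)}. y i \<in> points Y) \<and>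
        T ` B \<subseteq>
          (\<Union>i\<in>{1..2 ^ (n - 1)}. {y i + smul Y (of_real \<epsilon>) z | z. z \<in> closed_unit_ball Y}))}"

lemma covered_by_imp_entropy_radius:
  assumes cov: "covered_by Y (T ` B) (2 ^ (n - 1)) \<epsilon>" and \<epsilon>: "0 < \<epsilon>"
  shows "\<epsilon> \<in> entropy_radii n"
proof -
  obtain F where F: "finite F" "F \<subseteq> points Y" "card F \<le> 2 ^ (n - 1)"
    and net: "\<And>x. x \<in> B \<Longrightarrow> \<exists>y\<in>F. qnorm Y (T x - y) \<le> \<epsilon>"
    using cov unfolding covered_by_def by blast
  have "F \<noteq> {}" using net[OF zero_in_ball] by blast
  define N :: nat where "N = 2 ^ (n - 1)"
  obtain f where f: "f ` {..<card F} = F"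
    using F(1) by (metis bij_betw_imp_surj_on ex_bij_betw_nat_finite lessThan_atLeast0)
  \<comment> \<open>The index set has exactly \<open>2\<close> to the power \<open>n - 1\<close> elements, so surplus indices repeat a centre.\<close>
  define y where "y i = f (if i \<le> card F then i - 1 else 0)" for i
  have "card F > 0" using F(1) \<open>F \<noteq> {}\<close> by (simp add: card_gt_0_iff)
  have yF: "y i \<in> F" if "1 \<le> i" for i
  proof -
    have "(if i \<le> card F then i - 1 else 0) \<in> {..<card F}" using that \<open>card F > 0\<close> by auto
    then show ?thesis unfolding y_def using f by blast
  qed
  have cover: "\<exists>i\<in>{1..N}. \<exists>z\<in>closed_unit_ball Y. T x = y i + smul Y (of_real \<epsilon>) z" if x: "x \<in> B" for x
  proof -
    obtain w where w: "w \<in> F" "qnorm Y (T x - w) \<le> \<epsilon>" using net[OF x] by blast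
    then obtain i where i: "i < card F" "w = f i" using f by (metis imageE lessThan_iff)
    have p: "T x - w \<in> points Y" using w F T_points[OF ball_points[OF x]] by (auto intro: points_diff)
    let ?z = "smul Y (of_real (1 / \<epsilon>)) (T x - w)"
    have "qnorm Y ?z \<le> 1" using w \<epsilon> by (simp add: qnorm_smul[OF p] norm_divide)
    then have "?z \<in> closed_unit_ball Y"
      unfolding closed_unit_ball_def using p by (simp add: points_smul)
    moreover have "smul Y (of_real \<epsilon>) ?z = T x - w" using \<epsilon> by (simp flip: of_real_mult)
    then have "T x = y (Suc i) + smul Y (of_real \<epsilon>) ?z" unfolding y_def using i by simp
    moreover have "Suc i \<in> {1..N}" using i F(3) unfolding N_def by auto
    ultimately show ?thesis by blast
  qed
  have "\<forall>i\<in>{1..N}. y i \<in> points Y" using yF F(2) by auto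
  moreover have "T ` B \<subseteq> (\<Union>i\<in>{1..N}. {y i + smul Y (of_real \<epsilon>) z | z. z \<in> closed_unit_ball Y})"
    using cover by fastforce
  ultimately show ?thesis using \<epsilon> unfolding N_def by blast
qed

lemma entropy_radius_imp_covered_by:
  assumes "\<epsilon> \<in> entropy_radii n"
  shows "covered_by Y (T ` B) (2 ^ (n - 1)) \<epsilon>"
proof -
  define N :: nat where "N = 2 ^ (n - 1)"
  have "\<exists>y :: nat \<Rightarrow> 'w. (\<forall>i\<in>{1..N}. y i \<in> points Y) \<and>
    T ` B \<subseteq> (\<Union>i\<in>{1..N}. {y i + smul Y (of_real \<epsilon>) z | z. z \<in> closed_unit_ball Y})"
    and \<epsilon>: "0 < \<epsilon>" using assms unfolding N_def by simp_all
  then obtain y where y: "\<forall>i\<in>{1..N}. y i \<in> points Y"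
    and cov: "T ` B \<subseteq> (\<Union>i\<in>{1..N}. {y i + smul Y (of_real \<epsilon>) z | z. z \<in> closed_unit_ball Y})"
    by (elim exE conjE)
  have "\<exists>w\<in>y ` {1..N}. qnorm Y (v - w) \<le> \<epsilon>" if v: "v \<in> T ` B" for v
  proof -
    from subsetD[OF cov v] obtain i where i: "i \<in> {1..N}"
      and "v \<in> {y i + smul Y (of_real \<epsilon>) z | z. z \<in> closed_unit_ball Y}" by (rule UN_E)
    then obtain z where z: "v = y i + smul Y (of_real \<epsilon>) z" "z \<in> closed_unit_ball Y" by auto
    then have "qnorm Y (v - y i) = \<epsilon> * qnorm Y z"
      using \<epsilon> unfolding closed_unit_ball_def by (simp add: qnorm_smul)
    also have "\<dots> \<le> \<epsilon> * 1" using z(2) \<epsilon> unfolding closed_unit_ball_def by (intro mult_left_mono) auto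
    finally show ?thesis using i by auto
  qed
  moreover have "card (y ` {1..N}) \<le> N" using card_image_le[of "{1..N}" y] by simp
  moreover have "y ` {1..N} \<subseteq> points Y" using y by blast
  moreover have "finite (y ` {1..N})" by simp
  ultimately show ?thesis unfolding covered_by_def N_def[symmetric]
    by (intro exI[of _ "y ` {1..N}"] conjI ballI)
qed

lemma entropy_number_eq: "e n = Inf {\<epsilon>. 0 < \<epsilon> \<and> covered_by Y (T ` B) (2 ^ (n - 1)) \<epsilon>}"
proof -
  have "entropy_radii n = {\<epsilon>. 0 < \<epsilon> \<and> covered_by Y (T ` B) (2 ^ (n - 1)) \<epsilon>}"
  proof (intro equalityI subsetI)
    fix \<epsilon> assume \<epsilon>: "\<epsilon> \<in> entropy_radii n"
    have "0 < \<epsilon>" using \<epsilon> by simp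
    then show "\<epsilon> \<in> {\<epsilon>. 0 < \<epsilon> \<and> covered_by Y (T ` B) (2 ^ (n - 1)) \<epsilon>}"
      using entropy_radius_imp_covered_by[OF \<epsilon>] by simp
  next
    fix \<epsilon> assume "\<epsilon> \<in> {\<epsilon>. 0 < \<epsilon> \<and> covered_by Y (T ` B) (2 ^ (n - 1)) \<epsilon>}"
    then have "covered_by Y (T ` B) (2 ^ (n - 1)) \<epsilon>" "0 < \<epsilon>" by simp_all
    then show "\<epsilon> \<in> entropy_radii n" by (rule covered_by_imp_entropy_radius)
  qed
  then show ?thesis unfolding entropy_number_def by (rule arg_cong)
qed

lemma covering_radii_bdd_below: "bdd_below {\<epsilon>. 0 < \<epsilon> \<and> covered_by Y (T ` B) m \<epsilon>}"
  by (intro bdd_belowI[of _ 0]) auto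

lemma covering_radii_nonempty:
  assumes "1 \<le> m"
  shows "{\<epsilon>. 0 < \<epsilon> \<and> covered_by Y (T ` B) m \<epsilon>} \<noteq> {}"
proof -
  obtain K where K: "\<And>x. x \<in> B \<Longrightarrow> qnorm Y (T x) \<le> K" using bounded_on_ball[OF T] by blast
  have "covered_by Y (T ` B) m (max 1 K)"
    unfolding covered_by_def using K points_0 assms
    by (intro exI[of _ "{0}"]) (auto simp: le_max_iff_disj)
  moreover have "0 < max 1 K" by simp
  ultimately show ?thesis by blast
qed

lemma entropy_number_le:
  assumes "covered_by Y (T ` B) (2 ^ (n - 1)) \<epsilon>" "0 < \<epsilon>"
  shows "e n \<le> \<epsilon>"
  unfolding entropy_number_eq using assms by (intro cInf_lower covering_radii_bdd_below) simp

lemma entropy_number_nonneg: "0 \<le> e n"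
  unfolding entropy_number_eq by (intro cInf_greatest covering_radii_nonempty) auto

lemma entropy_number_antimono:
  assumes "m \<le> n"
  shows "e n \<le> e m"
proof -
  have "(2::nat) ^ (m - 1) \<le> 2 ^ (n - 1)" using assms by (intro power_increasing) auto
  then show ?thesis unfolding entropy_number_eq
    by (intro cInf_superset_mono covering_radii_nonempty covering_radii_bdd_below)
      (auto intro: covered_by_mono)
qed

lemma entropy_number_le_approximation_number_1: "e n \<le> a 1"
proof (rule field_le_epsilon)
  fix \<delta> :: real assume \<delta>: "0 < \<delta>"
  obtain S G where "finite G" "card G < 1" and S: "S ` points X \<subseteq> span G"
    and close: "\<And>x. x \<in> B \<Longrightarrow> qnorm Y (T x - S x) \<le> a 1 + \<delta>"
    by (rule near_best_approximation[OF order_refl \<delta>]) blast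
  then have "G = {}" by simp
  then have "\<And>x. x \<in> B \<Longrightarrow> S x = 0" using S ball_points by auto
  then have "covered_by Y (T ` B) (2 ^ (n - 1)) (a 1 + \<delta>)"
    unfolding covered_by_def using close points_0 \<open>\<And>x. x \<in> B \<Longrightarrow> S x = 0\<close>
    by (intro exI[of _ "{0}"]) auto
  then show "e n \<le> a 1 + \<delta>"
    using approximation_number_nonneg[of 1] \<delta> by (intro entropy_number_le) auto
qed

lemma convergent_entropy: "convergent e"
proof -
  have "decseq e" using entropy_number_antimono by (simp add: decseq_def)
  then obtain L where "e \<longlonglongrightarrow> L"
    by (rule decseq_convergent[of _ 0]) (simp_all add: entropy_number_nonneg)
  then show ?thesis by (rule convergentI)
qed

lemma convergent_approximation: "convergent a"
proof -
  have "decseq (\<lambda>n. a (Suc n))" using approximation_number_antimono by (simp add: decseq_def)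
  then obtain L where "(\<lambda>n. a (Suc n)) \<longlonglongrightarrow> L"
    by (rule decseq_convergent[of _ 0]) (simp_all add: approximation_number_nonneg)
  then have "convergent (\<lambda>n. a (Suc n))" by (rule convergentI)
  then show ?thesis by (simp only: convergent_Suc_iff)
qed

end

context bounded_operator
begin

section \<open>Dyadic approximation\<close>

text \<open>
  Let \<open>S\<^sub>j\<close> be a nearly best approximation of \<open>T\<close> of rank below \<open>2\<^sup>j\<close>, so that \<open>M\<^sub>j\<close> bounds its
  error on the unit ball, and \<open>\<theta> = 2\<^bsup>-w\<^esup>\<close>. The induction on \<open>j\<close> covers the image of \<open>S\<^sub>j\<close> by \<open>2\<close>
  to the power \<open>L 2\<^sup>j (t + 2)\<close> balls of radius \<open>2 C M\<^sub>j \<theta>\<^sup>t\<close>, simultaneously for all \<open>t\<close>. The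
  parameter \<open>t\<close> is what defeats the constant \<open>C\<close> of the triangle inequality: in
  \<open>S\<^sub>j\<^sub>+\<^sub>1 = S\<^sub>j + (S\<^sub>j\<^sub>+\<^sub>1 - S\<^sub>j)\<close> the rank doubles, and the doubled exponent suffices to cover
  both summands at level \<open>t + 1\<close>. The factor \<open>\<theta>\<close> gained in this way absorbs \<open>C\<close> and the growth
  factor \<open>\<kappa>\<close>, so that constants do not accumulate.
\<close>

lemma dyadic_covering:
  assumes \<delta>: "0 < \<delta>" and Ma: "\<And>j. a (2 ^ j) + \<delta> \<le> M j"
    and growth: "\<And>j. M j \<le> \<kappa> * M (Suc j)" and \<kappa>: "1 \<le> \<kappa>"
    and w: "2 * C * \<kappa> * (1 / 2) ^ w \<le> 1" and v: "8 * C ^ 3 * (1 / 2) ^ v \<le> 1"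
  defines "L \<equiv> 8 * (v + w)"
  shows "covered_by Y (T ` B) (2 ^ (2 * L * 2 ^ j)) (C * (2 * C + 1) * M j)"
proof -
  have C: "C > 0" using const_ge_1 by linarith
  define \<theta> :: real where "\<theta> = (1 / 2) ^ w"
  have \<theta>: "0 < \<theta>" "\<theta> \<le> 1" unfolding \<theta>_def by (auto intro: power_le_one)
  have M: "M j > 0" for j
    using Ma[of j] approximation_number_nonneg[of "2 ^ j"] \<delta> by simp
  have "\<exists>S G. finite G \<and> G \<subseteq> points Y \<and> card G < 2 ^ j \<and> S ` points X \<subseteq> span G \<and>
      (\<forall>x\<in>B. qnorm Y (T x - S x) \<le> a (2 ^ j) + \<delta>)" for j
  proof -
    obtain S G where "finite G" "G \<subseteq> points Y" "card G < 2 ^ j" "S ` points X \<subseteq> span G"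
      "\<And>x. x \<in> B \<Longrightarrow> qnorm Y (T x - S x) \<le> a (2 ^ j) + \<delta>"
      by (rule near_best_approximation[OF one_le_power \<delta>, of 2 j]) auto
    then show ?thesis by blast
  qed
  then obtain S G where G: "\<And>j. finite (G j)" "\<And>j. G j \<subseteq> points Y" "\<And>j. card (G j) < 2 ^ j"
    and SG: "\<And>j. S j ` points X \<subseteq> span (G j)"
    and TS: "\<And>j x. x \<in> B \<Longrightarrow> qnorm Y (T x - S j x) \<le> a (2 ^ j) + \<delta>" by metis
  have S: "S j x \<in> points Y" if "x \<in> B" for j x
    using SG[of j] span_minimal[OF G(2) points_subspace, of j] ball_points[OF that] by blast
  have cov: "covered_by Y (S j ` B) (2 ^ (L * 2 ^ j * (t + 2))) (2 * C * M j * \<theta> ^ t)" for j t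
  proof (induction j arbitrary: t)
    case 0
    have "G 0 = {}" using G(1,3)[of 0] by simp
    then have "S 0 x = 0" if "x \<in> B" for x using SG[of 0] ball_points[OF that] by auto
    then show ?case unfolding covered_by_def using points_0 C M[of 0] \<theta>
      by (intro exI[of _ "{0}"]) (auto simp: qnorm_0)
  next
    case (Suc j)
    let ?R = "\<lambda>x. S (Suc j) x - S j x"
    \<comment> \<open>\<open>v\<close> pays for the constant \<open>8 C\<^sup>3\<close> of the packing bound, the rest is \<open>\<theta>\<^bsup>t+1\<^esup>\<close>.\<close>
    define l :: real where "l = (1 / 2) ^ (v + w * (t + 1))"
    have "span (G j) \<subseteq> span (G j \<union> G (Suc j))" "span (G (Suc j)) \<subseteq> span (G j \<union> G (Suc j))"
      by (intro span_mono; blast)+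
    then have "?R x \<in> span (G j \<union> G (Suc j))" if "x \<in> B" for x
      using SG[of j] SG[of "Suc j"] ball_points[OF that] by (intro span_diff) blast+
    moreover have "qnorm Y (?R x) \<le> 2 * C * \<kappa> * M (Suc j)" if x: "x \<in> B" for x
    proof -
      have "T x - S j x \<in> points Y" "T x - S (Suc j) x \<in> points Y"
        using S[OF x] T_points[OF ball_points[OF x]] by (auto intro: points_diff)
      from qnorm_diff[OF this]
      have "qnorm Y (?R x) \<le> C * (qnorm Y (T x - S j x) + qnorm Y (T x - S (Suc j) x))"
        by simp
      also have "\<dots> \<le> C * (M j + M j)"
      proof (intro mult_left_mono add_mono)
        show "qnorm Y (T x - S j x) \<le> M j" using TS[OF x, of j] Ma[of j] by linarith
        have "a (2 ^ Suc j) \<le> a (2 ^ j)" by (rule approximation_number_antimono) auto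
        then show "qnorm Y (T x - S (Suc j) x) \<le> M j" using TS[OF x, of "Suc j"] Ma[of j] by linarith
      qed (use C in simp)
      also have "\<dots> \<le> 2 * C * (\<kappa> * M (Suc j))" using growth[of j] C by simp
      finally show ?thesis by simp
    qed
    moreover have "(1 / l) ^ (2 * card (G j \<union> G (Suc j))) \<le> real (2 ^ (L * 2 ^ j * (t + 1)))"
    proof -
      have "card (G j \<union> G (Suc j)) \<le> 4 * 2 ^ j"
        using card_Un_le[of "G j" "G (Suc j)"] G(3)[of j] G(3)[of "Suc j"] by simp
      moreover have "v + w * (t + 1) \<le> (v + w) * (t + 1)" by (simp add: algebra_simps)
      ultimately have "(v + w * (t + 1)) * (2 * card (G j \<union> G (Suc j))) \<le> ((v + w) * (t + 1)) * (2 * (4 * 2 ^ j))"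
        by (intro mult_le_mono) auto
      also have "\<dots> = L * 2 ^ j * (t + 1)" unfolding L_def by (simp add: algebra_simps)
      finally have "(2::real) ^ ((v + w * (t + 1)) * (2 * card (G j \<union> G (Suc j)))) \<le> 2 ^ (L * 2 ^ j * (t + 1))"
        by (intro power_increasing) auto
      moreover have "1 / l = 2 ^ (v + w * (t + 1))" unfolding l_def by (simp add: power_one_over)
      ultimately show ?thesis by (simp add: power_mult)
    qed
    moreover have "8 * C ^ 3 * l \<le> \<theta> ^ (t + 1)"
    proof -
      have "8 * C ^ 3 * l = (8 * C ^ 3 * (1 / 2) ^ v) * \<theta> ^ (t + 1)"
        unfolding l_def \<theta>_def by (simp only: power_add power_mult mult.assoc)
      also have "\<dots> \<le> 1 * \<theta> ^ (t + 1)" using v \<theta> by (intro mult_right_mono) auto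
      finally show ?thesis by simp
    qed
    moreover have "0 < l" unfolding l_def by simp
    moreover have "\<theta> ^ (t + 1) \<le> 1" using \<theta> by (intro power_le_one) auto
    ultimately have R: "covered_by Y (?R ` B) (2 ^ (L * 2 ^ j * (t + 1))) (2 * C * \<kappa> * M (Suc j) * \<theta> ^ (t + 1))"
      using G M[of "Suc j"] C \<kappa> \<theta>
      by (intro span_ball_covered[of "G j \<union> G (Suc j)" _ _ _ l]) auto
    have "covered_by Y ((\<lambda>x. S j x + ?R x) ` B) (2 ^ (L * 2 ^ j * (t + 1 + 2)) * 2 ^ (L * 2 ^ j * (t + 1)))
      (C * (2 * C * M j * \<theta> ^ (t + 1) + 2 * C * \<kappa> * M (Suc j) * \<theta> ^ (t + 1)))"
      using S by (intro covered_by_sum[OF _ _ Suc[of "t + 1"] R]) (auto intro: points_diff)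
    moreover have "2 ^ (L * 2 ^ j * (t + 1 + 2)) * 2 ^ (L * 2 ^ j * (t + 1)) \<le> (2::nat) ^ (L * 2 ^ Suc j * (t + 2))"
      unfolding power_add[symmetric] by (simp add: algebra_simps)
    moreover have "C * (2 * C * M j * \<theta> ^ (t + 1) + 2 * C * \<kappa> * M (Suc j) * \<theta> ^ (t + 1))
      \<le> 2 * C * M (Suc j) * \<theta> ^ t"
    proof -
      have "C * (2 * C * M j * \<theta> ^ (t + 1) + 2 * C * \<kappa> * M (Suc j) * \<theta> ^ (t + 1))
        = 2 * C ^ 2 * \<theta> ^ (t + 1) * (M j + \<kappa> * M (Suc j))"
        by (simp add: algebra_simps power2_eq_square)
      also have "\<dots> \<le> 2 * C ^ 2 * \<theta> ^ (t + 1) * (2 * (\<kappa> * M (Suc j)))"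
        using growth[of j] C \<theta> by (intro mult_left_mono) auto
      also have "\<dots> = (2 * C * \<kappa> * \<theta>) * (2 * C * M (Suc j) * \<theta> ^ t)"
        by (simp add: algebra_simps power2_eq_square)
      also have "\<dots> \<le> 1 * (2 * C * M (Suc j) * \<theta> ^ t)"
        using w C M[of "Suc j"] \<theta> unfolding \<theta>_def by (intro mult_right_mono) auto
      finally show ?thesis by simp
    qed
    ultimately show ?case by (auto intro: covered_by_mono)
  qed
  have cov0: "covered_by Y (S j ` B) (2 ^ (2 * L * 2 ^ j)) (2 * C * M j)"
  proof -
    have eq: "L * 2 ^ j * (0 + 2) = 2 * L * 2 ^ j" by (simp add: mult.assoc mult.commute)
    show ?thesis using cov[of j 0] unfolding eq by simp
  qed
  have "covered_by Y ((\<lambda>x. T x - S j x) ` B) 1 (M j)"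
    unfolding covered_by_def using points_0 order_trans[OF TS Ma]
    by (intro exI[of _ "{0}"]) auto
  then have "covered_by Y ((\<lambda>x. S j x + (T x - S j x)) ` B) (2 ^ (2 * L * 2 ^ j) * 1)
      (C * (2 * C * M j + M j))"
    using S T_points[OF ball_points] by (intro covered_by_sum[OF _ _ cov0]) (auto intro: points_diff)
  then show ?thesis by (simp add: algebra_simps)
qed

section \<open>Carl's inequality for means\<close>

definition approximation_mean :: "real \<Rightarrow> nat \<Rightarrow> real" where
  "approximation_mean p n = ((1 / real n) * (\<Sum>i=1..n. a i powr p)) powr (1 / p)"

text \<open>
  Serves three purposes: passing from one power of \<open>2\<close> to the next, from the nearest power of
  \<open>2\<close> to \<open>n\<close>, and from \<open>1\<close> to a bounded \<open>n\<close>.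
\<close>

lemma approximation_mean_comparison:
  assumes p: "0 < p" and k: "1 \<le> k" "k \<le> n" "real n \<le> q * real k"
  shows "approximation_mean p k \<le> q powr (1 / p) * approximation_mean p n"
proof -
  have q: "0 \<le> q"
  proof (rule ccontr)
    assume "\<not> 0 \<le> q"
    then have "q * real k \<le> 0" by (simp add: mult_nonpos_nonneg)
    then show False using k by linarith
  qed
  have "(\<Sum>i=1..k. a i powr p) \<le> (\<Sum>i=1..n. a i powr p)"
    using k by (intro sum_mono2) auto
  then have "(1 / real k) * (\<Sum>i=1..k. a i powr p) \<le> (q / real n) * (\<Sum>i=1..n. a i powr p)"
    using k by (intro mult_mono) (auto simp: field_simps sum_nonneg q)
  then have "approximation_mean p k \<le> ((q / real n) * (\<Sum>i=1..n. a i powr p)) powr (1 / p)"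
    unfolding approximation_mean_def using p by (intro powr_mono2) (auto simp: sum_nonneg)
  also have "\<dots> = (q * ((1 / real n) * (\<Sum>i=1..n. a i powr p))) powr (1 / p)"
    by simp
  also have "\<dots> = q powr (1 / p) * approximation_mean p n"
    unfolding approximation_mean_def by (rule powr_mult)
  finally show ?thesis .
qed

lemma approximation_number_le_mean:
  assumes p: "0 < p" and n: "1 \<le> n"
  shows "a n \<le> approximation_mean p n"
proof -
  have "(\<Sum>i=1..n. a n powr p) \<le> (\<Sum>i=1..n. a i powr p)"
    using p n approximation_number_antimono approximation_number_nonneg
    by (intro sum_mono powr_mono2) auto
  then have "a n powr p \<le> (1 / real n) * (\<Sum>i=1..n. a i powr p)"
    using n by (simp add: field_simps)
  then have "(a n powr p) powr (1 / p) \<le> approximation_mean p n"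
    unfolding approximation_mean_def using p by (intro powr_mono2) auto
  then show ?thesis using p approximation_number_nonneg[OF n] by (simp add: powr_powr)
qed

text \<open>
  A covering with \<open>2\<close> to the power \<open>2 L 2\<^sup>j\<close> balls bounds the entropy numbers from index
  \<open>2 L 2\<^sup>j + 1\<close> on. The means at \<open>2\<^sup>j\<close> majorise the approximation numbers and grow backwards by
  at most \<open>2\<close> to the power \<open>1 / p\<close>, so they are admissible radii in the dyadic covering. For
  \<open>n \<le> 2 L\<close> a single ball is enough.
\<close>

lemma entropy_number_le_mean:
  assumes p: "0 < p" and n: "1 \<le> n"
    and w: "2 * C * 2 powr (1 / p) * (1 / 2) ^ w \<le> 1" and v: "8 * C ^ 3 * (1 / 2) ^ v \<le> 1"
  defines "L \<equiv> 8 * (v + w)"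
  shows "e n \<le> C * (2 * C + 1) * real (4 * L) powr (1 / p) * approximation_mean p n"
proof -
  have D: "1 \<le> C * (2 * C + 1)"
    using mult_mono[OF const_ge_1, of 1 "2 * C + 1"] const_ge_1 by simp
  \<comment> \<open>The factor \<open>8 C\<^sup>3\<close> exceeds \<open>1\<close>, so \<open>v\<close> is positive and division by \<open>L\<close> is legitimate.\<close>
  have "v \<noteq> 0"
  proof
    assume "v = 0"
    then show False using v one_le_power[OF const_ge_1, of 3] by simp
  qed
  then have L: "1 \<le> L" unfolding L_def by simp
  have A: "0 \<le> approximation_mean p k" for k unfolding approximation_mean_def by simp
  obtain k where k: "1 \<le> k" "k \<le> n" "n \<le> 4 * L * k" "e n \<le> C * (2 * C + 1) * approximation_mean p k"
  proof (cases "n \<le> 2 * L")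
    case True
    have "e n \<le> 1 * approximation_mean p 1"
      using order_trans[OF entropy_number_le_approximation_number_1 approximation_number_le_mean[OF p order_refl]]
      by simp
    also have "\<dots> \<le> C * (2 * C + 1) * approximation_mean p 1"
      using D A by (intro mult_right_mono)
    finally show ?thesis using that[of 1] True n by simp
  next
    case False
    then have "1 \<le> (n - 1) div (2 * L)" using L by (simp add: div_greater_zero_iff Suc_le_eq)
    then obtain j where j: "2 ^ j \<le> (n - 1) div (2 * L)" "(n - 1) div (2 * L) < 2 ^ (j + 1)"
      using ex_power_ivl1[of 2 "(n - 1) div (2 * L)"] by auto
    have jn: "2 * L * 2 ^ j \<le> n - 1"
      using mult_le_mono[OF order_refl j(1), of "2 * L"] times_div_less_eq_dividend[of "2 * L" "n - 1"]
      by linarith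
    have "n - 1 < 2 ^ (j + 1) * (2 * L)" using j(2) L by (simp add: div_less_iff_less_mult)
    then have nj: "n \<le> 4 * L * 2 ^ j" by (simp add: ac_simps)
    have "2 ^ j \<le> 2 * L * 2 ^ j" using L by simp
    then have "2 ^ j \<le> n" using jn by linarith
    moreover have "e n \<le> C * (2 * C + 1) * approximation_mean p (2 ^ j)"
    proof (rule field_le_epsilon)
      fix \<eta> :: real assume \<eta>: "0 < \<eta>"
      \<comment> \<open>A positive \<open>\<delta>\<close> keeps the radii positive when all approximation numbers vanish.\<close>
      define \<delta> where "\<delta> = \<eta> / (C * (2 * C + 1))"
      have \<delta>: "0 < \<delta>" unfolding \<delta>_def using \<eta> D by simp
      let ?M = "\<lambda>j. approximation_mean p (2 ^ j) + \<delta>"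
      have \<kappa>: "1 \<le> (2::real) powr (1 / p)" using p by (simp add: ge_one_powr_ge_zero)
      have "covered_by Y (T ` B) (2 ^ (2 * L * 2 ^ j)) (C * (2 * C + 1) * ?M j)"
        unfolding L_def
      proof (rule dyadic_covering[OF \<delta> _ _ \<kappa> w v])
        show "a (2 ^ j) + \<delta> \<le> ?M j" for j using approximation_number_le_mean[OF p, of "2 ^ j"] by simp
        show "?M j \<le> 2 powr (1 / p) * ?M (Suc j)" for j
          using approximation_mean_comparison[OF p, of "2 ^ j" "2 ^ Suc j" 2] \<kappa>
            mult_right_mono[OF \<kappa> less_imp_le[OF \<delta>]] by (simp add: algebra_simps)
      qed
      moreover have "(2::nat) ^ (2 * L * 2 ^ j) \<le> 2 ^ (n - 1)"
        using jn by (rule power_increasing) simp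
      ultimately have "covered_by Y (T ` B) (2 ^ (n - 1)) (C * (2 * C + 1) * ?M j)"
        by (rule covered_by_mono) (rule order_refl)
      moreover have "0 < ?M j" using A[of "2 ^ j"] \<delta> by linarith
      then have "0 < C * (2 * C + 1) * ?M j" using D by (intro mult_pos_pos[of "C * (2 * C + 1)"]) linarith
      ultimately have "e n \<le> C * (2 * C + 1) * ?M j" by (rule entropy_number_le)
      also have "\<dots> = C * (2 * C + 1) * approximation_mean p (2 ^ j) + C * (2 * C + 1) * \<delta>"
        by (rule distrib_left)
      also have "C * (2 * C + 1) * \<delta> = \<eta>" 
        unfolding \<delta>_def times_divide_eq_right by (rule nonzero_mult_div_cancel_left) (use D in linarith)
      finally show "e n \<le> C * (2 * C + 1) * approximation_mean p (2 ^ j) + \<eta>" .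
    qed
    ultimately show ?thesis using that[of "2 ^ j"] nj by simp
  qed
  have "real n \<le> real (4 * L) * real k" using k(3) by (simp flip: of_nat_mult)
  then have "approximation_mean p k \<le> real (4 * L) powr (1 / p) * approximation_mean p n"
    using approximation_mean_comparison[OF p k(1,2)] by blast
  then have "C * (2 * C + 1) * approximation_mean p k
    \<le> C * (2 * C + 1) * (real (4 * L) powr (1 / p) * approximation_mean p n)"
    using D by (intro mult_left_mono) linarith+
  then show ?thesis using k(4) by (simp add: mult.assoc)
qed

section \<open>Limits\<close>

text \<open>
  An operator of finite rank maps the unit ball to a set covered by finitely many balls of any
  prescribed radius, and the radius tends to \<open>0\<close> while the approximation stays fixed.
\<close>

lemma near_best_approximation_precompact:
  assumes "1 \<le> n" "0 < \<delta>" "0 < \<theta>"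
  obtains S k where "\<And>x. x \<in> B \<Longrightarrow> S x \<in> points Y" "covered_by Y (S ` B) (2 ^ k) \<theta>"
    "\<And>x. x \<in> B \<Longrightarrow> qnorm Y (T x - S x) \<le> a n + \<delta>"
proof -
  have C: "C > 0" using const_ge_1 by linarith
  obtain S G where G: "finite G" "G \<subseteq> points Y" and SG: "S ` points X \<subseteq> span G"
    and TS: "\<And>x. x \<in> B \<Longrightarrow> qnorm Y (T x - S x) \<le> a n + \<delta>"
    using near_best_approximation[OF assms(1,2)] by metis
  have S: "S x \<in> points Y" if "x \<in> B" for x
    using SG span_minimal[OF G(2) points_subspace] ball_points[OF that] by blast
  obtain K where K: "\<And>x. x \<in> B \<Longrightarrow> qnorm Y (T x) \<le> K" using bounded_on_ball[OF T] by blast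
  \<comment> \<open>The quasi-triangle inequality for \<open>S x = T x - (T x - S x)\<close>; \<open>max\<close> makes \<open>\<rho>\<close> positive.\<close>
  define \<rho> where "\<rho> = max 1 (C * (K + (a n + \<delta>)))"
  have \<rho>: "0 < \<rho>" unfolding \<rho>_def by simp
  have S\<rho>: "qnorm Y (S x) \<le> \<rho>" if x: "x \<in> B" for x
  proof -
    have t: "T x \<in> points Y" by (rule T_points[OF ball_points[OF x]])
    from qnorm_diff[OF t points_diff[OF t S[OF x]]]
    have "qnorm Y (S x) \<le> C * (qnorm Y (T x) + qnorm Y (T x - S x))" by simp
    also have "\<dots> \<le> C * (K + (a n + \<delta>))" using K[OF x] TS[OF x] C by (intro mult_left_mono add_mono) auto
    finally show ?thesis unfolding \<rho>_def by simp
  qed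
  define \<epsilon> where "\<epsilon> = min 1 (\<theta> / \<rho>)"
  have \<epsilon>: "0 < \<epsilon>" "\<epsilon> \<le> 1" "\<rho> * \<epsilon> \<le> \<theta>" unfolding \<epsilon>_def using assms(3) \<rho>
    by (auto simp: min_def field_simps)
  define l where "l = \<epsilon> / (8 * C ^ 3)"
  have l: "0 < l" "8 * C ^ 3 * l \<le> \<epsilon>" unfolding l_def using \<epsilon> C by auto
  obtain k where k: "(1 / l) ^ (2 * card G) < 2 ^ k" using real_arch_pow[of 2 "(1 / l) ^ (2 * card G)"] by auto
  have "covered_by Y (S ` B) (2 ^ k) (\<rho> * \<epsilon>)"
    using SG ball_points S\<rho> k by (intro span_ball_covered[OF G _ _ \<rho> \<epsilon>(1,2) l]) auto
  then have "covered_by Y (S ` B) (2 ^ k) \<theta>" by (rule covered_by_mono) (use \<epsilon> in auto)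
  then show thesis using that S TS by blast
qed

lemma lim_entropy_le: "lim e \<le> e n"
  using entropy_number_antimono convergent_entropy
  by (intro decseq_ge) (auto simp: decseq_def convergent_LIMSEQ_iff)

lemma le_lim_approximation:
  assumes "\<And>n. 1 \<le> n \<Longrightarrow> x \<le> a n"
  shows "x \<le> lim a"
  using convergent_approximation assms
  by (intro LIMSEQ_le_const[of a]) (auto simp: convergent_LIMSEQ_iff)

lemma lim_entropy_le_const: "lim e \<le> C * lim a"
proof -
  have C: "C > 0" using const_ge_1 by linarith
  have "lim e / C \<le> a n" if n: "1 \<le> n" for n
  proof (rule field_le_epsilon)
    fix \<eta> :: real assume "0 < \<eta>"
    then obtain S k where S: "\<And>x. x \<in> B \<Longrightarrow> S x \<in> points Y" and cov: "covered_by Y (S ` B) (2 ^ k) (\<eta> / 2)"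
      and TS: "\<And>x. x \<in> B \<Longrightarrow> qnorm Y (T x - S x) \<le> a n + \<eta> / 2"
      using near_best_approximation_precompact[OF n, of "\<eta> / 2" "\<eta> / 2"] by auto
    have "covered_by Y ((\<lambda>x. T x - S x) ` B) 1 (a n + \<eta> / 2)"
      unfolding covered_by_def using points_0 TS by (intro exI[of _ "{0}"]) auto
    then have "covered_by Y ((\<lambda>x. S x + (T x - S x)) ` B) (2 ^ k * 1) (C * (\<eta> / 2 + (a n + \<eta> / 2)))"
      using S T_points[OF ball_points] by (intro covered_by_sum[OF _ _ cov]) (auto intro: points_diff)
    then have "covered_by Y (T ` B) (2 ^ (Suc k - 1)) (C * (a n + \<eta>))" by (simp add: algebra_simps)
    then have "e (Suc k) \<le> C * (a n + \<eta>)"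
      using C approximation_number_nonneg[OF n] \<open>0 < \<eta>\<close> by (intro entropy_number_le) auto
    then have "lim e \<le> C * (a n + \<eta>)" using lim_entropy_le[of "Suc k"] by linarith
    then show "lim e / C \<le> a n + \<eta>" using C by (simp add: field_simps)
  qed
  then have "lim e / C \<le> lim a" by (rule le_lim_approximation)
  then show ?thesis using C by (simp add: field_simps)
qed

text \<open>
  An \<open>r\<close>-norm makes the radii \<open>s\<^bsup>1/r\<^esup>\<close> and \<open>a\<^sub>n + \<delta>\<close> combine to \<open>((a\<^sub>n + \<delta>)\<^sup>r + s)\<^bsup>1/r\<^esup>\<close>, which
  tends to \<open>a\<^sub>n + \<delta>\<close> as \<open>s\<close> tends to \<open>0\<close>, whereas the quasi-triangle inequality would leave the
  factor \<open>C\<close>.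
\<close>

lemma lim_entropy_le_if_r_norm:
  assumes "r_norm Y r"
  shows "lim e \<le> lim a"
proof (rule le_lim_approximation, rule field_le_epsilon)
  fix n :: nat and \<delta> :: real assume n: "1 \<le> n" and \<delta>: "0 < \<delta>"
  have r: "0 < r" and r_add: "\<And>x y. x \<in> points Y \<Longrightarrow> y \<in> points Y \<Longrightarrow>
      qnorm Y (x + y) powr r \<le> qnorm Y x powr r + qnorm Y y powr r"
    using assms unfolding r_norm_def by auto
  have pos: "0 < a n + \<delta>" using approximation_number_nonneg[OF n] \<delta> by linarith
  have "lim e powr r \<le> (a n + \<delta>) powr r"
  proof (rule field_le_epsilon)
    fix s :: real assume s: "0 < s"
    then obtain S k where S: "\<And>x. x \<in> B \<Longrightarrow> S x \<in> points Y"
      and cov: "covered_by Y (S ` B) (2 ^ k) (s powr (1 / r))"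
      and TS: "\<And>x. x \<in> B \<Longrightarrow> qnorm Y (T x - S x) \<le> a n + \<delta>"
      using near_best_approximation_precompact[OF n \<delta>, of "s powr (1 / r)"] by auto
    let ?\<epsilon> = "((a n + \<delta>) powr r + s) powr (1 / r)"
    obtain F where F: "finite F" "F \<subseteq> points Y" "card F \<le> 2 ^ k"
      and net: "\<And>x. x \<in> B \<Longrightarrow> \<exists>y\<in>F. qnorm Y (S x - y) \<le> s powr (1 / r)"
      using cov unfolding covered_by_def by blast
    have "\<exists>y\<in>F. qnorm Y (T x - y) \<le> ?\<epsilon>" if x: "x \<in> B" for x
    proof -
      obtain y where y: "y \<in> F" "qnorm Y (S x - y) \<le> s powr (1 / r)" using net[OF x] by blast
      have p: "T x - S x \<in> points Y" "S x - y \<in> points Y" "T x - y \<in> points Y"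
        using S[OF x] T_points[OF ball_points[OF x]] y(1) F(2) by (auto intro!: points_diff)
      have "qnorm Y (T x - y) powr r \<le> qnorm Y (T x - S x) powr r + qnorm Y (S x - y) powr r"
        using r_add[OF p(1,2)] by simp
      also have "\<dots> \<le> (a n + \<delta>) powr r + (s powr (1 / r)) powr r"
        using TS[OF x] y(2) r p by (intro add_mono powr_mono2) (auto intro: qnorm_nonneg)
      also have "(s powr (1 / r)) powr r = s" using r s by (simp add: powr_powr)
      finally have "(qnorm Y (T x - y) powr r) powr (1 / r) \<le> ?\<epsilon>"
        using r by (intro powr_mono2) auto
      then show ?thesis using y(1) r qnorm_nonneg[OF p(3)] by (auto simp: powr_powr)
    qed
    then have "covered_by Y (T ` B) (2 ^ (Suc k - 1)) ?\<epsilon>" unfolding covered_by_def using F by auto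
    moreover have sum_pos: "0 < (a n + \<delta>) powr r + s" using s by (simp add: add_nonneg_pos)
    ultimately have "lim e \<le> ?\<epsilon>"
      using lim_entropy_le[of "Suc k"] entropy_number_le[of "Suc k" ?\<epsilon>] by simp
    moreover have "0 \<le> lim e"
      using entropy_number_nonneg convergent_entropy
      by (intro LIMSEQ_le_const[of e]) (auto simp: convergent_LIMSEQ_iff)
    ultimately have "lim e powr r \<le> ?\<epsilon> powr r" using r by (intro powr_mono2) auto
    also have "\<dots> = (a n + \<delta>) powr r + s" using r sum_pos by (simp add: powr_powr)
    finally show "lim e powr r \<le> (a n + \<delta>) powr r + s" .
  qed
  then show "lim e \<le> a n + \<delta>" using powr_less_mono2[OF r, of "a n + \<delta>" "lim e"] pos by linarith
qed

end

section \<open>A constant uniform in the spaces and the operator\<close>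

lemma bounded_operatorI:
  assumes "quasi_banach_space X CX" "quasi_banach_space Y C" "T \<in> bounded_operators X Y"
  shows "bounded_operator X Y CX C T"
  using assms unfolding bounded_operator_def bounded_operator_axioms_def quasi_banach_space_def by blast

theorem theorem25:
  fixes p C\<^sub>X C\<^sub>Y :: real
  assumes "0 < p"
  shows
    "(\<exists>c>0. \<forall>(X :: ('k::real_or_complex, 'v::ab_group_add) space_data)
              (Y :: ('k, 'w::ab_group_add) space_data) T.
        quasi_banach_space X C\<^sub>X \<longrightarrow> quasi_banach_space Y C\<^sub>Y \<longrightarrow> T \<in> bounded_operators X Y \<longrightarrow>
        (\<forall>n\<ge>1. entropy_number X Y T n \<le>
           c * ((1 / real n) * (\<Sum>i=1..n. approximation_number X Y T i powr p)) powr (1 / p))) \<and>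
     (\<forall>(X :: ('k, 'v) space_data) (Y :: ('k, 'w) space_data) T.
        quasi_banach_space X C\<^sub>X \<longrightarrow> quasi_banach_space Y C\<^sub>Y \<longrightarrow> T \<in> bounded_operators X Y \<longrightarrow>
        convergent (entropy_number X Y T) \<and> convergent (approximation_number X Y T) \<and>
        lim (entropy_number X Y T) \<le> C\<^sub>Y * lim (approximation_number X Y T) \<and>
        ((\<exists>r. r_norm Y r) \<longrightarrow>
           lim (entropy_number X Y T) \<le> lim (approximation_number X Y T)))"
    (is "(\<exists>c>0. ?carl c) \<and> ?limits")
proof
  show "\<exists>c>0. ?carl c"
  proof (cases "1 \<le> C\<^sub>Y")
    case True
    obtain w where "(1 / 2) ^ w < 1 / (2 * C\<^sub>Y * 2 powr (1 / p))"
      using real_arch_pow_inv[of "1 / (2 * C\<^sub>Y * 2 powr (1 / p))" "1 / 2"] True by auto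
    then have w: "2 * C\<^sub>Y * 2 powr (1 / p) * (1 / 2) ^ w \<le> 1" using True by (simp add: field_simps)
    obtain v where "(1 / 2) ^ v < 1 / (8 * C\<^sub>Y ^ 3)"
      using real_arch_pow_inv[of "1 / (8 * C\<^sub>Y ^ 3)" "1 / 2"] True by auto
    then have v: "8 * C\<^sub>Y ^ 3 * (1 / 2) ^ v \<le> 1" using True by (simp add: field_simps)
    let ?c = "C\<^sub>Y * (2 * C\<^sub>Y + 1) * real (4 * (8 * (v + w))) powr (1 / p)"
    have "v \<noteq> 0"
    proof
      assume "v = 0"
      then show False using v one_le_power[OF True, of 3] by simp
    qed
    then have "0 < ?c" using True by simp
    moreover have "?carl ?c"
    proof (intro allI impI)
      fix X :: "('k, 'v) space_data" and Y :: "('k, 'w) space_data" and T and n :: nat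
      assume "quasi_banach_space X C\<^sub>X" "quasi_banach_space Y C\<^sub>Y" "T \<in> bounded_operators X Y"
      then interpret bounded_operator X Y C\<^sub>X C\<^sub>Y T by (rule bounded_operatorI)
      assume "1 \<le> n"
      from entropy_number_le_mean[OF assms this w v]
      show "e n \<le> ?c * ((1 / real n) * (\<Sum>i=1..n. a i powr p)) powr (1 / p)"
        unfolding approximation_mean_def .
    qed
    ultimately show ?thesis by blast
  next
    case False
    \<comment> \<open>There is no space with such a constant.\<close>
    then have "\<not> quasi_banach_space Y C\<^sub>Y" for Y :: "('k, 'w) space_data"
      unfolding quasi_banach_space_def quasi_normed_space_def quasi_normed_space_axioms_def by blast
    then show ?thesis by (intro exI[of _ 1]) auto
  qed
  show ?limits
  proof (intro allI impI)
    fix X :: "('k, 'v) space_data" and Y :: "('k, 'w) space_data" and T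
    assume "quasi_banach_space X C\<^sub>X" "quasi_banach_space Y C\<^sub>Y" "T \<in> bounded_operators X Y"
    then interpret bounded_operator X Y C\<^sub>X C\<^sub>Y T by (rule bounded_operatorI)
    show "convergent e \<and> convergent a \<and> lim e \<le> C\<^sub>Y * lim a \<and> ((\<exists>r. r_norm Y r) \<longrightarrow> lim e \<le> lim a)"
      using convergent_entropy convergent_approximation lim_entropy_le_const lim_entropy_le_if_r_norm
      by blast
  qed
qed

end
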